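(* The following four minimization problems are pairwise equivalent under cost-preserving reductions: (1) \textsc{Nearest Codeword}, (2) \textsc{Odd Set}, (3) $\mathrm{MinCSP}(B_2)$, and (4) $\mathrm{MinCSP}(B_3)$, where $B_2=\{\mathrm{EVEN}^4,\{1\},\{0\}\}$ and $B_3=\{\mathrm{EVEN}^4,\{(0,1),(1,0)\}\}$.
   Context: $\mathrm{EVEN}^4=\{a\in\{0,1\}^4:\sum_i a_i\text{ is even}\}$. For a finite set $\Gamma$ of Boolean relations, an instance of $\mathrm{MinCSP}(\Gamma)$ consists of variables $V$ and constraints $\mathcal{C}$ (pairs $\langle s,R\rangle$ with $R\in\Gamma$ and $s$ a tuple of variables of the arity of $R$); a feasible solution is a set $W\subseteq\mathcal{C}$ such that some assignment $V\to\{0,1\}$ satisfies every constraint in $\mathcal{C}\setminus W$; its cost is $|W|$, to be minimized. \textsc{Nearest Codeword}: given an $m\times n$ matrix $A$ over $\mathrm{GF}(2)$ and $b\in\mathrm{GF}(2)^m$, find $x\in\mathrm{GF}(2)^n$ minimizing the Hamming distance between $Ax$ and $b$ (the cost). \textsc{Odd Set}: given a set system $\{S_1,\dots,S_m\}$ over a universe $U$, a feasible solution is $T\subseteq U$ with $|S_i\cap T|$ odd for every $i$; its cost is $|T|$, to be minimized. A cost-preserving reduction from minimization problem $P$ to $Q$ is a pair of polynomial-time functions $F,G$ such that for every feasible instance $I$ of $P$ (one having a feasible solution), $F(I)$ is a feasible instance of $Q$ with the same optimum cost as $I$, and for every feasible solution $S'$ of $F(I)$, $G(I,S')$ is a feasible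 solution of $I$ of cost at most the cost of $S'$. *)

theory Defs
  imports Main
begin

text \<open>Words are bool lists. A function of arity n is represented by a function on
bool list list that is applied to argument lists of length n. cobham n f says that
(the restriction to length-n argument lists of) f belongs to Cobham's class, i.e.
is polynomial-time computable (Cobham 1965): initial functions empty word,
successors (prepend a bit), projections, smash; closure under composition and
limited recursion on notation.\<close>

inductive cobham :: "nat \<Rightarrow> (bool list list \<Rightarrow> bool list) \<Rightarrow> bool" where
  empty: "cobham n (\<lambda>xs. [])"
| succ: "cobham 1 (\<lambda>xs. b # hd xs)"
| proj: "i < n \<Longrightarrow> cobham n (\<lambda>xs. xs ! i)"
| smash: "cobham 2 (\<lambda>xs. replicate (length (xs ! 0) * length (xs ! 1)) True)"
| comp: "cobham m h \<Longrightarrow> length gs = m \<Longrightarrow> (\<forall>g\<in>set gs. cobham n g) \<Longrightarrow>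
          cobham n (\<lambda>xs. h (map (\<lambda>g. g xs) gs))"
| lrn: "cobham n g \<Longrightarrow> cobham (n + 2) h0 \<Longrightarrow> cobham (n + 2) h1 \<Longrightarrow> cobham (n + 1) k \<Longrightarrow>
         (\<forall>ys. length ys = n \<longrightarrow> f ([] # ys) = g ys) \<Longrightarrow>
         (\<forall>x ys. length ys = n \<longrightarrow> f ((False # x) # ys) = h0 (x # f (x # ys) # ys)) \<Longrightarrow>
         (\<forall>x ys. length ys = n \<longrightarrow> f ((True # x) # ys) = h1 (x # f (x # ys) # ys)) \<Longrightarrow>
         (\<forall>x ys. length ys = n \<longrightarrow> length (f (x # ys)) \<le> length (k (x # ys))) \<Longrightarrow>
         cobham (n + 1) f"

definition dbl :: "bool list \<Rightarrow> bool list" where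
  "dbl w = concat (map (\<lambda>b. [b, b]) w)"

definition enc_seq :: "bool list list \<Rightarrow> bool list" where
  "enc_seq ws = concat (map (\<lambda>w. dbl w @ [False, True]) ws)"

definition unary :: "nat \<Rightarrow> bool list" where
  "unary n = replicate n True"

fun bin :: "nat \<Rightarrow> bool list" where
  "bin n = (if n = 0 then [] else odd n # bin (n div 2))"

record ('i, 's) minprob =
  inst :: "'i \<Rightarrow> bool"
  sol :: "'i \<Rightarrow> 's \<Rightarrow> bool"
  cost :: "'i \<Rightarrow> 's \<Rightarrow> nat"
  enc_i :: "'i \<Rightarrow> bool list"
  enc_s :: "'s \<Rightarrow> bool list"

definition feasible_inst :: "('i, 's) minprob \<Rightarrow> 'i \<Rightarrow> bool" where
  "feasible_inst P I \<longleftrightarrow> inst P I \<and> (\<exists>S. sol P I S)"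

definition opt :: "('i, 's) minprob \<Rightarrow> 'i \<Rightarrow> nat" where
  "opt P I = (LEAST c. \<exists>S. sol P I S \<and> cost P I S = c)"

definition cp_reduces :: "('i, 's) minprob \<Rightarrow> ('j, 't) minprob \<Rightarrow> bool" where
  "cp_reduces P Q \<longleftrightarrow> (\<exists>F G. cobham 1 F \<and> cobham 2 G \<and>
     (\<forall>I. feasible_inst P I \<longrightarrow>
        (\<exists>J. F [enc_i P I] = enc_i Q J \<and> feasible_inst Q J \<and> opt Q J = opt P I \<and>
             (\<forall>S'. sol Q J S' \<longrightarrow>
                (\<exists>S. G [enc_i P I, enc_s Q S'] = enc_s P S \<and> sol P I S \<and>
                     cost P I S \<le> cost Q J S')))))"

definition cp_equivalent :: "('i, 's) minprob \<Rightarrow> ('j, 't) minprob \<Rightarrow> bool" where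
  "cp_equivalent P Q \<longleftrightarrow> cp_reduces P Q \<and> cp_reduces Q P"

text \<open>Nearest Codeword: instance (n, A, b), A given as list of its m rows (each of length n),
b of length m; solution x of length n; cost = Hamming distance of Ax and b over GF(2).\<close>
definition gf2_dot :: "bool list \<Rightarrow> bool list \<Rightarrow> bool" where
  "gf2_dot r x = odd (card {j. j < length r \<and> r ! j \<and> x ! j})"

definition nearest_codeword :: "(nat \<times> bool list list \<times> bool list, bool list) minprob" where
  "nearest_codeword = \<lparr>
     inst = (\<lambda>(n, A, b). length b = length A \<and> (\<forall>r\<in>set A. length r = n)),
     sol = (\<lambda>(n, A, b) x. length x = n),
     cost = (\<lambda>(n, A, b) x. card {i. i < length A \<and> gf2_dot (A ! i) x \<noteq> b ! i}),
     enc_i = (\<lambda>(n, A, b). enc_seq [unary n, enc_seq A, b]),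
     enc_s = (\<lambda>x. x) \<rparr>"

text \<open>Odd Set: universe U = {0..<n}; sets S_i given by characteristic vectors of length n;
solution T given by its characteristic vector.\<close>
definition odd_set :: "(nat \<times> bool list list, bool list) minprob" where
  "odd_set = \<lparr>
     inst = (\<lambda>(n, Ss). \<forall>S\<in>set Ss. length S = n),
     sol = (\<lambda>(n, Ss) T. length T = n \<and>
              (\<forall>S\<in>set Ss. odd (card {j. j < n \<and> S ! j \<and> T ! j}))),
     cost = (\<lambda>(n, Ss) T. card {j. j < n \<and> T ! j}),
     enc_i = (\<lambda>(n, Ss). enc_seq [unary n, enc_seq Ss]),
     enc_s = (\<lambda>T. T) \<rparr>"

text \<open>MinCSP(Gamma): Gamma is a list of (arity, relation) pairs, relations being sets of
bool lists (True = 1). Instance: variables {0..<n} and a duplicate-free list of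
constraints (r, s) meaning the relation Gamma ! r applied to the variable tuple s.
A solution W is the set of deleted constraints, given as a bool vector over the
constraint list; cost = |W|.\<close>
definition mincsp :: "(nat \<times> bool list set) list \<Rightarrow> (nat \<times> (nat \<times> nat list) list, bool list) minprob" where
  "mincsp \<Gamma> = \<lparr>
     inst = (\<lambda>(n, cs). distinct cs \<and>
              (\<forall>(r, s)\<in>set cs. r < length \<Gamma> \<and> length s = fst (\<Gamma> ! r) \<and> (\<forall>v\<in>set s. v < n))),
     sol = (\<lambda>(n, cs) W. length W = length cs \<and>
              (\<exists>\<alpha> :: nat \<Rightarrow> bool. \<forall>i < length cs. \<not> W ! i \<longrightarrow>
                  map \<alpha> (snd (cs ! i)) \<in> snd (\<Gamma> ! fst (cs ! i)))),
     cost = (\<lambda>(n, cs) W. card {i. i < length W \<and> W ! i}),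
     enc_i = (\<lambda>(n, cs). enc_seq [unary n, enc_seq (map (\<lambda>(r, s). enc_seq (bin r # map bin s)) cs)]),
     enc_s = (\<lambda>W. W) \<rparr>"

definition EVEN4 :: "bool list set" where
  "EVEN4 = {a. length a = 4 \<and> even (length (filter id a))}"

definition B2 :: "(nat \<times> bool list set) list" where
  "B2 = [(4, EVEN4), (1, {[True]}), (1, {[False]})]"

definition B3 :: "(nat \<times> bool list set) list" where
  "B3 = [(4, EVEN4), (2, {[False, True], [True, False]})]"

end

theory Submission
  imports Defs "HOL-Library.Z2"
begin

text \<open>The equivalences follow from a cycle of reductions Nearest Codeword, Odd Set, MinCSP(B2),
  MinCSP(B3), Nearest Codeword. The last step just reads every constraint as a parity equation, and
  B2 reduces to B3 by adding one variable that plays the role of 0. Since costs are preserved exactly,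
  the first step has to recognise the instances of optimum 0; it passes from the code to its parity
  checks by Gaussian elimination, justified by the Fredholm alternative over GF(2). The second step
  breaks the parity equations into chains of EVEN4 constraints, repeated often enough that deleting
  all copies is too expensive. In the first two steps solutions are mapped back by solving a linear
  system, restricted to the intact equations or to the deleted variables respectively.\<close>

subsection \<open>Polynomial-time functions\<close>

text \<open>Polynomial time is a syntactic class here, so both maps of every reduction have to be
  assembled from Cobham's functions. Numbers are handled in unary, which suffices because instances
  give their dimension in unary. The obstacle is the length bound that each recursion demands. The
  linear algebra is shaped by this: a single operation clears and drops the first coordinate of a
  list of rows while keeping the number of rows. Repeated k times it cuts the row space down to its
  vectors with k leading zeros. Identity blocks appended to the rows record coefficients, so
  solutions and parity checks are both read off without echelon forms or back substitution. Optimum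
  0 is special in Odd Set because an odd intersection forces T to be nonempty: every nonempty set
  system has positive optimum. Solutions carry no witness: T comes without a codeword, and a
  deletion set W without an assignment. This is why mapping solutions back means solving a
  system.\<close>

text \<open>Unlike \<open>cobham\<close>, the predicate \<open>pt\<close> ignores the values of f on argument lists of the wrong
  length, which makes it extensional.\<close>

definition pt :: "nat \<Rightarrow> (bool list list \<Rightarrow> bool list) \<Rightarrow> bool" where
  "pt n f \<longleftrightarrow> (\<exists>g. cobham n g \<and> (\<forall>xs. length xs = n \<longrightarrow> g xs = f xs))"

lemma pt_cong: "pt n f \<Longrightarrow> (\<And>xs. length xs = n \<Longrightarrow> f xs = g xs) \<Longrightarrow> pt n g"
  unfolding pt_def by metis

lemma pt_compose:
  assumes h: "pt m h" and m: "length gs = m" and gs: "\<forall>g\<in>set gs. pt n g"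
  shows "pt n (\<lambda>xs. h (map (\<lambda>g. g xs) gs))"
proof -
  obtain h' where h': "cobham m h'" "\<forall>xs. length xs = m \<longrightarrow> h' xs = h xs"
    using h unfolding pt_def by blast
  have "\<forall>g\<in>set gs. \<exists>g'. cobham n g' \<and> (\<forall>xs. length xs = n \<longrightarrow> g' xs = g xs)"
    using gs unfolding pt_def by blast
  then obtain c where c: "\<forall>g\<in>set gs. cobham n (c g) \<and> (\<forall>xs. length xs = n \<longrightarrow> c g xs = g xs)"
    by metis
  have "cobham n (\<lambda>xs. h' (map (\<lambda>g. g xs) (map c gs)))"
    by (rule cobham.comp[OF h'(1)]) (use m c in auto)
  moreover have "h' (map (\<lambda>g. g xs) (map c gs)) = h (map (\<lambda>g. g xs) gs)" if "length xs = n" for xs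
  proof -
    have "map (\<lambda>g. g xs) (map c gs) = map (\<lambda>g. g xs) gs" using c that by auto
    then show ?thesis using h'(2) m by (metis length_map)
  qed
  ultimately show ?thesis unfolding pt_def by blast
qed

lemma pt_lift1: "pt 1 H \<Longrightarrow> pt n a \<Longrightarrow> pt n (\<lambda>xs. H [a xs])"
  using pt_compose[of 1 H "[a]" n] by simp

lemma pt_lift2: "pt 2 H \<Longrightarrow> pt n a \<Longrightarrow> pt n b \<Longrightarrow> pt n (\<lambda>xs. H [a xs, b xs])"
  using pt_compose[of 2 H "[a, b]" n] by simp

lemma pt_lift3: "pt 3 H \<Longrightarrow> pt n a \<Longrightarrow> pt n b \<Longrightarrow> pt n c \<Longrightarrow> pt n (\<lambda>xs. H [a xs, b xs, c xs])"
  using pt_compose[of 3 H "[a, b, c]" n] by simp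

lemma pt_lift4:
  "pt 4 H \<Longrightarrow> pt n a \<Longrightarrow> pt n b \<Longrightarrow> pt n c \<Longrightarrow> pt n d \<Longrightarrow> pt n (\<lambda>xs. H [a xs, b xs, c xs, d xs])"
  using pt_compose[of 4 H "[a, b, c, d]" n] by simp

text \<open>Binders extend the argument list at the front, so a variable of an enclosing scope
  appears below k binders as an entry of the k-fold tail.\<close>

definition tail_has :: "nat \<Rightarrow> nat \<Rightarrow> (bool list list \<Rightarrow> bool list list) \<Rightarrow> bool" where
  "tail_has n i t \<longleftrightarrow> (\<exists>k. k + i < n \<and> (\<forall>zs. length zs = n \<longrightarrow> t zs = drop k zs))"

lemma tail_has_id: "i < n \<Longrightarrow> tail_has n i (\<lambda>zs. zs)"
  unfolding tail_has_def by (intro exI[of _ 0]) auto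

lemma tail_has_tl: "tail_has n (Suc i) t \<Longrightarrow> tail_has n i (\<lambda>zs. tl (t zs))"
  unfolding tail_has_def by (metis add_Suc add_Suc_right drop_Suc tl_drop)

lemma pt_proj: "i < n \<Longrightarrow> pt n (\<lambda>xs. xs ! i)"
  unfolding pt_def using cobham.proj by blast

lemma pt_nth: "tail_has n i t \<Longrightarrow> pt n (\<lambda>zs. t zs ! i)"
  unfolding tail_has_def by (elim exE conjE, rule pt_cong[OF pt_proj]) auto

lemma pt_hd: "tail_has n 0 t \<Longrightarrow> pt n (\<lambda>zs. hd (t zs))"
  unfolding tail_has_def by (elim exE conjE, rule pt_cong[OF pt_proj]) (auto simp: hd_drop_conv_nth)

lemma pt_nil: "pt n (\<lambda>_. [])"
  unfolding pt_def using cobham.empty by blast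

lemma pt_Cons0: "pt n f \<Longrightarrow> pt n (\<lambda>xs. b # f xs)"
proof -
  assume f: "pt n f"
  have "pt 1 (\<lambda>xs. b # hd xs)" unfolding pt_def using cobham.succ by blast
  from pt_lift1[OF this f] show ?thesis by simp
qed

lemma pt_const: "pt n (\<lambda>_. w)"
  by (induction w) (auto intro: pt_nil pt_Cons0)

lemma pt_smash: "pt n f \<Longrightarrow> pt n g \<Longrightarrow> pt n (\<lambda>xs. replicate (length (f xs) * length (g xs)) True)"
proof -
  assume fg: "pt n f" "pt n g"
  have "pt 2 (\<lambda>xs. replicate (length (xs ! 0) * length (xs ! 1)) True)"
    unfolding pt_def using cobham.smash by blast
  from pt_lift2[OF this fg] show ?thesis by simp
qed

primrec wrec :: "bool list \<Rightarrow> (bool \<Rightarrow> bool list \<Rightarrow> bool list \<Rightarrow> bool list) \<Rightarrow> bool list \<Rightarrow> bool list" where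
  "wrec g h [] = g"
| "wrec g h (b # x) = h b x (wrec g h x)"

lemma pt_wrec:
  assumes g: "pt n g"
    and h: "\<And>b. pt (n + 2) (\<lambda>zs. h b (hd zs) (hd (tl zs)) (tl (tl zs)))"
    and k: "pt (n + 1) k"
    and bound: "\<And>x ys. length ys = n \<Longrightarrow>
      length (wrec (g ys) (\<lambda>b x r. h b x r ys) x) \<le> length (k (x # ys))"
  shows "pt (n + 1) (\<lambda>zs. wrec (g (tl zs)) (\<lambda>b x r. h b x r (tl zs)) (hd zs))"
proof -
  obtain g' where g': "cobham n g'" "\<forall>xs. length xs = n \<longrightarrow> g' xs = g xs"
    using g unfolding pt_def by blast
  obtain hf where hf: "cobham (n + 2) hf"
    "\<forall>xs. length xs = n + 2 \<longrightarrow> hf xs = h False (hd xs) (hd (tl xs)) (tl (tl xs))"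
    using h[of False] unfolding pt_def by blast
  obtain ht where ht: "cobham (n + 2) ht"
    "\<forall>xs. length xs = n + 2 \<longrightarrow> ht xs = h True (hd xs) (hd (tl xs)) (tl (tl xs))"
    using h[of True] unfolding pt_def by blast
  obtain k' where k': "cobham (n + 1) k'" "\<forall>xs. length xs = n + 1 \<longrightarrow> k' xs = k xs"
    using k unfolding pt_def by blast
  have "cobham (n + 1) (\<lambda>zs. wrec (g (tl zs)) (\<lambda>b x r. h b x r (tl zs)) (hd zs))"
    by (rule cobham.lrn[OF g'(1) hf(1) ht(1) k'(1)])
      (use g'(2) hf(2) ht(2) k'(2) bound in auto)
  then show ?thesis unfolding pt_def by blast
qed

lemmas pt_basic = pt_nth pt_hd pt_const tail_has_id tail_has_tl

lemma pt_append: "pt n f \<Longrightarrow> pt n g \<Longrightarrow> pt n (\<lambda>xs. f xs @ g xs)"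
proof -
  assume fg: "pt n f" "pt n g"
  have eq: "wrec y (\<lambda>b x r. b # r) x = x @ y" for x y by (induction x) auto
  have k: "pt (1 + 1) (\<lambda>zs. replicate (length (True # hd zs) * length (True # zs ! 1)) True)"
    by (intro pt_smash pt_Cons0 pt_basic) auto
  have "pt (1 + 1) (\<lambda>zs. wrec (hd (tl zs)) (\<lambda>b x r. b # r) (hd zs))"
    by (rule pt_wrec[where g = hd and h = "\<lambda>b x r ys. b # r", OF _ _ k])
      (auto simp: eq length_Suc_conv, (intro pt_Cons0 pt_basic; simp)+)
  then have "pt 2 (\<lambda>zs. hd zs @ hd (tl zs))" by (simp add: eq numeral_2_eq_2)
  from pt_lift2[OF this fg] show ?thesis by simp
qed

lemma pt_tl: "pt n f \<Longrightarrow> pt n (\<lambda>xs. tl (f xs))"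
proof -
  assume f: "pt n f"
  have eq: "wrec [] (\<lambda>b x r. x) x = tl x" for x by (cases x) auto
  have k: "pt (0 + 1) (\<lambda>zs. hd zs)" by (intro pt_basic) auto
  have "pt (0 + 1) (\<lambda>zs. wrec [] (\<lambda>b x r. x) (hd zs))"
    by (rule pt_wrec[where g = "\<lambda>_. []" and h = "\<lambda>b x r ys. x", OF _ _ k])
      (auto simp: eq, (intro pt_basic; simp)+)
  then have "pt 1 (\<lambda>zs. tl (hd zs))" by (simp add: eq)
  from pt_lift1[OF this f] show ?thesis by simp
qed

text \<open>The separate branch for the empty word lets the same conditional test emptiness, which
  is how unary numbers are compared.\<close>

definition sel :: "bool list \<Rightarrow> bool list \<Rightarrow> bool list \<Rightarrow> bool list \<Rightarrow> bool list" where
  "sel w a b c = (case w of [] \<Rightarrow> a | x # _ \<Rightarrow> if x then b else c)"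

lemma pt_sel: "pt n w \<Longrightarrow> pt n a \<Longrightarrow> pt n b \<Longrightarrow> pt n c \<Longrightarrow> pt n (\<lambda>xs. sel (w xs) (a xs) (b xs) (c xs))"
proof -
  assume fg: "pt n w" "pt n a" "pt n b" "pt n c"
  have eq: "wrec a (\<lambda>h x r. if h then b else c) x = sel x a b c" for x a b c
    by (cases x) (auto simp: sel_def)
  \<comment> \<open>The result is one of the three branches, hence no longer than their
    concatenation.\<close>
  have k: "pt (3 + 1) (\<lambda>zs. zs ! 1 @ zs ! 2 @ zs ! 3)"
    by (intro pt_append pt_basic) auto
  have "pt (3 + 1) (\<lambda>zs. wrec (tl zs ! 0) (\<lambda>h x r. if h then tl zs ! 1 else tl zs ! 2) (hd zs))"
  proof (rule pt_wrec[where g = "\<lambda>ys. ys ! 0" and h = "\<lambda>h x r ys. if h then ys ! 1 else ys ! 2", OF _ _ k])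
    show "pt (3 + 2) (\<lambda>zs. if b then tl (tl zs) ! 1 else tl (tl zs) ! 2)" for b
      by (cases b; simp only: if_True if_False; intro pt_basic; simp)
    show "pt 3 (\<lambda>ys. ys ! 0)" by (intro pt_basic) simp
  qed (auto simp: eq sel_def split: list.split)
  then have "pt 4 (\<lambda>zs. sel (hd zs) (tl zs ! 0) (tl zs ! 1) (tl zs ! 2))" by (simp add: eq)
  from pt_lift4[OF this fg] show ?thesis by simp
qed

lemma pt_drop_length: "pt n k \<Longrightarrow> pt n f \<Longrightarrow> pt n (\<lambda>xs. drop (length (k xs)) (f xs))"
proof -
  assume fg: "pt n k" "pt n f"
  have eq: "wrec y (\<lambda>b x r. tl r) x = drop (length x) y" for x y
    by (induction x) (auto simp: drop_Suc tl_drop)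
  have k: "pt (1 + 1) (\<lambda>zs. hd (tl zs))" by (intro pt_basic) auto
  have "pt (1 + 1) (\<lambda>zs. wrec (hd (tl zs)) (\<lambda>b x r. tl r) (hd zs))"
    by (rule pt_wrec[where g = hd and h = "\<lambda>b x r ys. tl r", OF _ _ k])
      (auto simp: eq, (intro pt_tl pt_basic; simp)+)
  then have "pt 2 (\<lambda>zs. drop (length (hd zs)) (hd (tl zs)))" by (simp add: eq numeral_2_eq_2)
  from pt_lift2[OF this fg] show ?thesis by simp
qed

definition ptn :: "nat \<Rightarrow> (bool list list \<Rightarrow> nat) \<Rightarrow> bool" where
  "ptn n f \<longleftrightarrow> pt n (\<lambda>xs. unary (f xs))"

definition ptb :: "nat \<Rightarrow> (bool list list \<Rightarrow> bool) \<Rightarrow> bool" where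
  "ptb n f \<longleftrightarrow> pt n (\<lambda>xs. [f xs])"

lemma length_unary [simp]: "length (unary n) = n"
  by (simp add: unary_def)

lemma ptn_length: "pt n f \<Longrightarrow> ptn n (\<lambda>xs. length (f xs))"
  using pt_smash[of n f "\<lambda>_. [True]"] by (simp add: ptn_def unary_def pt_const)

lemma pt_unary: "ptn n f \<Longrightarrow> pt n (\<lambda>xs. unary (f xs))"
  by (simp add: ptn_def)

lemma ptn_const: "ptn n (\<lambda>_. c)"
  by (simp add: ptn_def pt_const)

lemma ptn_Suc: "ptn n f \<Longrightarrow> ptn n (\<lambda>xs. Suc (f xs))"
  unfolding ptn_def using pt_Cons0[of n "\<lambda>xs. unary (f xs)" True] by (simp add: unary_def)

lemma ptn_plus: "ptn n f \<Longrightarrow> ptn n g \<Longrightarrow> ptn n (\<lambda>xs. f xs + g xs)"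
  unfolding ptn_def using pt_append[of n "\<lambda>xs. unary (f xs)" "\<lambda>xs. unary (g xs)"]
  by (simp add: unary_def replicate_add)

lemma ptn_times: "ptn n f \<Longrightarrow> ptn n g \<Longrightarrow> ptn n (\<lambda>xs. f xs * g xs)"
  unfolding ptn_def using pt_smash[of n "\<lambda>xs. unary (f xs)" "\<lambda>xs. unary (g xs)"]
  by (simp add: unary_def)

lemma pt_drop: "ptn n k \<Longrightarrow> pt n f \<Longrightarrow> pt n (\<lambda>xs. drop (k xs) (f xs))"
  unfolding ptn_def using pt_drop_length[of n "\<lambda>xs. unary (k xs)" f] by simp

lemma ptn_minus: "ptn n f \<Longrightarrow> ptn n g \<Longrightarrow> ptn n (\<lambda>xs. f xs - g xs)"
  using pt_drop[of n g "\<lambda>xs. unary (f xs)"] by (simp add: ptn_def unary_def)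

lemma ptb_const: "ptb n (\<lambda>_. c)"
  by (simp add: ptb_def pt_const)

lemma pt_Cons: "ptb n P \<Longrightarrow> pt n f \<Longrightarrow> pt n (\<lambda>xs. P xs # f xs)"
  unfolding ptb_def using pt_append[of n "\<lambda>xs. [P xs]" f] by simp

lemma pt_if: "ptb n P \<Longrightarrow> pt n f \<Longrightarrow> pt n g \<Longrightarrow> pt n (\<lambda>xs. if P xs then f xs else g xs)"
  unfolding ptb_def using pt_sel[of n "\<lambda>xs. [P xs]" f f g] by (simp add: sel_def cong: if_cong)

lemma ptb_if: "ptb n P \<Longrightarrow> ptb n Q \<Longrightarrow> ptb n R \<Longrightarrow> ptb n (\<lambda>xs. if P xs then Q xs else R xs)"
  using pt_if[of n P "\<lambda>xs. [Q xs]" "\<lambda>xs. [R xs]"] by (simp add: ptb_def if_distrib[of "\<lambda>x. [x]"] cong: if_cong)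

lemma ptn_if: "ptb n P \<Longrightarrow> ptn n f \<Longrightarrow> ptn n g \<Longrightarrow> ptn n (\<lambda>xs. if P xs then f xs else g xs)"
  unfolding ptn_def using pt_if[of n P "\<lambda>xs. unary (f xs)" "\<lambda>xs. unary (g xs)"]
  by (simp add: if_distrib[of unary])

lemma ptb_cong: "ptb n f \<Longrightarrow> (\<And>xs. length xs = n \<Longrightarrow> f xs = g xs) \<Longrightarrow> ptb n g"
  unfolding ptb_def by (erule pt_cong) simp

lemma ptb_not: "ptb n P \<Longrightarrow> ptb n (\<lambda>xs. \<not> P xs)"
  by (rule ptb_cong[OF ptb_if[of n P "\<lambda>_. False" "\<lambda>_. True"]]) (auto intro: ptb_const)

lemma ptb_and: "ptb n P \<Longrightarrow> ptb n Q \<Longrightarrow> ptb n (\<lambda>xs. P xs \<and> Q xs)"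
  by (rule ptb_cong[OF ptb_if[of n P Q "\<lambda>_. False"]]) (auto intro: ptb_const)

lemma ptb_iff: "ptb n P \<Longrightarrow> ptb n Q \<Longrightarrow> ptb n (\<lambda>xs. P xs = Q xs)"
  by (rule ptb_cong[OF ptb_if[of n P Q "\<lambda>xs. \<not> Q xs"]]) (auto intro: ptb_not)

lemma ptb_less: "ptn n f \<Longrightarrow> ptn n g \<Longrightarrow> ptb n (\<lambda>xs. f xs < g xs)"
proof -
  assume "ptn n f" "ptn n g"
  then have "pt n (\<lambda>xs. sel (unary (g xs - f xs)) [False] [True] [True])"
    by (intro pt_sel pt_unary ptn_minus pt_const)
  then show ?thesis unfolding ptb_def
    by (rule pt_cong) (auto simp: sel_def unary_def neq_Nil_conv[symmetric] split: list.split)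
qed

lemma ptb_le: "ptn n f \<Longrightarrow> ptn n g \<Longrightarrow> ptb n (\<lambda>xs. f xs \<le> g xs)"
  using ptb_not[OF ptb_less[of n g f]] by (simp add: not_less)

lemma ptb_eq: "ptn n f \<Longrightarrow> ptn n g \<Longrightarrow> ptb n (\<lambda>xs. f xs = g xs)"
  using ptb_and[OF ptb_le[of n f g] ptb_le[of n g f]] by (simp add: eq_iff)

text \<open>Total lookup: reading past the end gives False, so words act as vectors padded with
  zeros and \<open>[]\<close> acts as the zero vector.\<close>

definition nthb :: "bool list \<Rightarrow> nat \<Rightarrow> bool" where
  "nthb w i \<longleftrightarrow> i < length w \<and> w ! i"

lemma ptb_nthb: "pt n w \<Longrightarrow> ptn n i \<Longrightarrow> ptb n (\<lambda>xs. nthb (w xs) (i xs))"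
proof -
  assume "pt n w" "ptn n i"
  then have "pt n (\<lambda>xs. sel (drop (i xs) (w xs)) [False] [True] [False])"
    by (intro pt_sel pt_drop pt_const)
  moreover have "sel (drop i w) [False] [True] [False] = [nthb w i]" for i w
    by (cases "i < length w") (auto simp: sel_def nthb_def Cons_nth_drop_Suc[symmetric])
  ultimately show ?thesis unfolding ptb_def by simp
qed

section \<open>Variables, substitution and bounded iteration\<close>

lemma pt_reindex:
  assumes f: "pt m f" and idx: "\<And>i. i < m \<Longrightarrow> idx i < n"
  shows "pt n (\<lambda>xs. f (map (\<lambda>i. xs ! idx i) [0..<m]))"
proof -
  have "pt n (\<lambda>xs. f (map (\<lambda>g. g xs) (map (\<lambda>i xs. xs ! idx i) [0..<m])))"
    by (rule pt_compose[OF f]) (use idx in \<open>auto intro: pt_proj\<close>)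
  then show ?thesis by (simp add: o_def)
qed

lemma pt_shift: "pt n f \<Longrightarrow> pt (Suc n) (\<lambda>zs. f (tl zs))"
  by (rule pt_cong[OF pt_reindex[of n f Suc]], simp, simp, rule arg_cong[of _ _ f])
    (auto intro!: nth_equalityI simp: nth_tl)

text \<open>A recursion step has index and accumulator in front of the parameters. A loop body that
  reads only the index has to skip the second argument.\<close>

lemma pt_shift_body:
  assumes "pt (Suc n) (\<lambda>zs. F (hd zs) (tl zs))"
  shows "pt (Suc (Suc n)) (\<lambda>zs. F (hd zs) (tl (tl zs)))"
proof (rule pt_cong[OF pt_reindex[OF assms, of "\<lambda>i. if i = 0 then 0 else Suc i"]])
  fix xs :: "bool list list" assume "length xs = Suc (Suc n)"
  then obtain a b ys where xs: "xs = a # b # ys" "length ys = n"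
    by (auto simp: length_Suc_conv)
  have "map (\<lambda>i. xs ! (if i = 0 then 0 else Suc i)) [0..<Suc n] = a # ys"
    by (rule nth_equalityI) (auto simp: xs nth_Cons' simp del: upt_Suc)
  then show "F (hd (map (\<lambda>i. xs ! (if i = 0 then 0 else Suc i)) [0..<Suc n]))
      (tl (map (\<lambda>i. xs ! (if i = 0 then 0 else Suc i)) [0..<Suc n])) = F (hd xs) (tl (tl xs))"
    by (simp add: xs(1) del: upt_Suc)
qed simp

lemma pt_let:
  assumes F: "pt (Suc n) (\<lambda>zs. F (hd zs) (tl zs))" and a: "pt n a"
  shows "pt n (\<lambda>xs. F (a xs) xs)"
proof -
  have "pt n (\<lambda>xs. (\<lambda>zs. F (hd zs) (tl zs)) (map (\<lambda>g. g xs) (a # map (\<lambda>i xs. xs ! i) [0..<n])))"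
    by (rule pt_compose[OF F]) (use a in \<open>auto intro: pt_proj\<close>)
  moreover have "map (\<lambda>g. g xs) (map (\<lambda>i xs. xs ! i) [0..<n]) = xs" if "length xs = n" for xs :: "bool list list"
    by (rule nth_equalityI) (use that in auto)
  ultimately show ?thesis by (elim pt_cong) simp
qed

text \<open>Inside the recursion below the value is truncated to its last \<open>length (k xs)\<close> letters, so that
  the length bound, which is only assumed up to the actual argument, holds for all words.\<close>

lemma pt_rec_nat:
  assumes m: "ptn n m" and g: "pt n g"
    and h: "pt (Suc (Suc n)) (\<lambda>zs. h (length (hd zs)) (hd (tl zs)) (tl (tl zs)))"
    and k: "pt n k"
    and bound: "\<And>xs i. length xs = n \<Longrightarrow> i \<le> m xs \<Longrightarrow>
      length (rec_nat (g xs) (\<lambda>i r. h i r xs) i) \<le> length (k xs)"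
  shows "pt n (\<lambda>xs. rec_nat (g xs) (\<lambda>i r. h i r xs) (m xs))"
proof -
  define trunc where "trunc c w = drop (length (drop (length c) w)) w" for c w :: "bool list"
  have trunc_id: "trunc c w = w" if "length w \<le> length c" for c w
    using that by (simp add: trunc_def)
  have trunc_le: "length (trunc c w) \<le> length c" for c w
    by (simp add: trunc_def)
  have pt_trunc: "pt n' a \<Longrightarrow> pt n' b \<Longrightarrow> pt n' (\<lambda>xs. trunc (a xs) (b xs))" for n' a b
    unfolding trunc_def by (intro pt_drop_length)
  have k2: "pt (n + 2) (\<lambda>zs. k (tl (tl zs)))"
    using pt_shift[OF pt_shift[OF k]] by simp
  have k1: "pt (n + 1) (\<lambda>zs. k (tl zs))"
    using pt_shift[OF k] by simp
  define H where "H i r xs = trunc (k xs) (h i r xs)" for i r xs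
  define G where "G xs = trunc (k xs) (g xs)" for xs
  define R where "R xs = wrec (G xs) (\<lambda>_ x r. H (length x) r xs)" for xs
  have len_R: "length (R xs x) \<le> length (k xs)" for xs x
    by (cases x) (auto simp: R_def G_def H_def trunc_le)
  have step: "pt (n + 1) (\<lambda>zs. R (tl zs) (hd zs))"
    unfolding R_def
  proof (rule pt_wrec[where g = G and h = "\<lambda>_ x r. H (length x) r" and k = "\<lambda>zs. k (tl zs)"])
    show "pt n G" unfolding G_def by (intro pt_trunc g k)
    show "pt (n + 2) (\<lambda>zs. H (length (hd zs)) (hd (tl zs)) (tl (tl zs)))" for b :: bool
      unfolding H_def by (intro pt_trunc k2) (use h in simp)
    show "pt (n + 1) (\<lambda>zs. k (tl zs))" by (fact k1)
  qed (use len_R in \<open>auto simp: R_def\<close>)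
  have eq: "R xs (replicate i True) = rec_nat (g xs) (\<lambda>i r. h i r xs) i"
    if "i \<le> m xs" "length xs = n" for xs i
    using that
  proof (induction i)
    case 0
    then show ?case using bound[of xs 0] by (simp add: R_def G_def trunc_id)
  next
    case (Suc i)
    then show ?case using bound[of xs "Suc i"] by (simp add: R_def H_def trunc_id)
  qed
  have "pt n (\<lambda>xs. R xs (unary (m xs)))"
    using pt_let[of n "\<lambda>w xs. R xs w" "\<lambda>xs. unary (m xs)"] step m by (simp add: ptn_def)
  then show ?thesis
    by (rule pt_cong) (simp add: eq unary_def)
qed

text \<open>Loops need a computable bound on their accumulator. This one holds for every function of
  the class, so users of the loop combinators need not supply any. The base is at least 2 so that
  powers of it absorb constants and sums.\<close>

lemma cobham_length_bound:
  "cobham n f \<Longrightarrow> \<exists>d. \<forall>xs. length xs = n \<longrightarrow> length (f xs) \<le> (2 + length (concat xs)) ^ d"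
proof (induction rule: cobham.induct)
  case (empty n)
  then show ?case by auto
next
  case (succ b)
  show ?case by (rule exI[of _ 1]) (auto simp: length_Suc_conv)
next
  case (proj i n)
  have "length (xs ! i) \<le> length (concat xs)" if "i < length xs" for xs :: "bool list list"
    using that by (simp add: length_concat member_le_sum_list)
  then show ?case using proj by (intro exI[of _ 1]) (auto intro: le_SucI)
next
  case smash
  have "length (xs ! 0) * length (xs ! 1) \<le> (2 + length (concat xs)) ^ 2"
    if "length xs = 2" for xs :: "bool list list"
  proof -
    have "length (xs ! 0) \<le> 2 + length (concat xs)" "length (xs ! 1) \<le> 2 + length (concat xs)"
      using that by (auto simp: length_Suc_conv numeral_2_eq_2)
    then show ?thesis unfolding power2_eq_square by (rule mult_le_mono)
  qed
  then show ?case by auto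
next
  case (comp m h gs n)
  obtain d where d: "\<And>xs. length xs = m \<Longrightarrow> length (h xs) \<le> (2 + length (concat xs)) ^ d"
    using comp.IH by blast
  obtain e where e: "\<And>g xs. g \<in> set gs \<Longrightarrow> length xs = n \<Longrightarrow> length (g xs) \<le> (2 + length (concat xs)) ^ e g"
    using comp(4) by metis
  define E where "E = Max (insert 0 (e ` set gs))"
  have E: "length (g xs) \<le> (2 + length (concat xs)) ^ E" if "g \<in> set gs" "length xs = n" for g xs
  proof -
    have "e g \<le> E" unfolding E_def using that by auto
    then have "(2 + length (concat xs)) ^ e g \<le> (2 + length (concat xs)) ^ E"
      by (intro power_increasing) auto
    then show ?thesis using e[OF that] by linarith
  qed
  have "length (h (map (\<lambda>g. g xs) gs)) \<le> (2 + length (concat xs)) ^ ((m + 1 + E) * d)"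
    if l: "length xs = n" for xs
  proof -
    let ?S = "2 + length (concat xs)"
    have "length (concat (map (\<lambda>g. g xs) gs)) \<le> length gs * ?S ^ E"
    proof -
      have "sum_list (map (\<lambda>g. length (g xs)) gs) \<le> sum_list (map (\<lambda>g. ?S ^ E) gs)"
        by (rule sum_list_mono) (use E l in auto)
      then show ?thesis by (simp add: length_concat o_def sum_list_triv)
    qed
    \<comment> \<open>The m inner results and the additive 2 cost m + 1 extra factors, since m + 2
      is at most 2 to the power m + 1.\<close>
    moreover have "2 + m * ?S ^ E \<le> ?S ^ (m + 1 + E)"
    proof -
      have "m + 2 \<le> 2 ^ (m + 1)" by (induction m) auto
      also have "\<dots> \<le> ?S ^ (m + 1)" by (intro power_mono) auto
      finally have "(m + 2) * ?S ^ E \<le> ?S ^ (m + 1) * ?S ^ E" by (rule mult_le_mono1)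
      moreover have "2 * 1 \<le> 2 * ?S ^ E" by (intro mult_le_mono2) simp
      then have "2 + m * ?S ^ E \<le> m * ?S ^ E + 2 * ?S ^ E" by linarith
      ultimately show ?thesis unfolding add_mult_distrib by (simp only: power_add)
    qed
    ultimately have "2 + length (concat (map (\<lambda>g. g xs) gs)) \<le> ?S ^ (m + 1 + E)"
      using comp(2) by simp
    then have "(2 + length (concat (map (\<lambda>g. g xs) gs))) ^ d \<le> (?S ^ (m + 1 + E)) ^ d"
      by (intro power_mono) auto
    then have "(2 + length (concat (map (\<lambda>g. g xs) gs))) ^ d \<le> ?S ^ ((m + 1 + E) * d)"
      by (simp only: power_mult)
    then show ?thesis using d[of "map (\<lambda>g. g xs) gs"] comp(2)
      by (intro le_trans[OF d]) simp_all
  qed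
  then show ?case by blast
next
  case (lrn n g h0 h1 k f)
  obtain d where d: "\<And>xs. length xs = n + 1 \<Longrightarrow> length (k xs) \<le> (2 + length (concat xs)) ^ d"
    using lrn.IH by blast
  show ?case
  proof (intro exI allI impI)
    fix xs :: "bool list list" assume l: "length xs = n + 1"
    then obtain x ys where "xs = x # ys" "length ys = n" by (metis Suc_eq_plus1 length_Suc_conv)
    then show "length (f xs) \<le> (2 + length (concat xs)) ^ d"
      using lrn.hyps l d le_trans by metis
  qed
qed

text \<open>A bound used in a recursion must itself be computable. The exponent d is fixed
  beforehand, so iterated multiplication produces the power in unary.\<close>

lemma ptn_power_size: "ptn n m \<Longrightarrow> ptn n (\<lambda>xs. (m xs + (2 + length (concat xs))) ^ d)"
proof -
  assume m: "ptn n m"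
  have "pt n (\<lambda>xs. concat (take j xs))" if "j \<le> n" for j
    using that
  proof (induction j)
    case (Suc j)
    have "pt n (\<lambda>xs. concat (take j xs) @ xs ! j)"
      using Suc by (intro pt_append pt_proj) auto
    then show ?case by (rule pt_cong) (use Suc.prems in \<open>auto simp: take_Suc_conv_app_nth\<close>)
  qed (simp add: pt_nil)
  from this[of n] have c: "pt n concat" by (rule pt_cong) auto
  show ?thesis
    by (induction d) (auto intro!: ptn_times ptn_plus ptn_const ptn_length c m)
qed

text \<open>Each piece has polynomially bounded length by \<open>cobham_length_bound\<close>, so m
  times that bound dominates the accumulator throughout. Maps, counts and bounded quantifiers are
  all derived from this loop.\<close>

lemma pt_concat_upt:
  assumes m: "ptn n m" and \<phi>: "pt (Suc n) (\<lambda>zs. \<phi> (length (hd zs)) (tl zs))"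
  shows "pt n (\<lambda>xs. concat (map (\<lambda>i. \<phi> i xs) [0..<m xs]))"
proof -
  obtain f where f: "cobham (Suc n) f" "\<And>zs. length zs = Suc n \<Longrightarrow> f zs = \<phi> (length (hd zs)) (tl zs)"
    using \<phi> unfolding pt_def by blast
  obtain d where d: "\<And>xs. length xs = Suc n \<Longrightarrow> length (f xs) \<le> (2 + length (concat xs)) ^ d"
    using cobham_length_bound[OF f(1)] by blast
  \<comment> \<open>The index enters the body as \<open>unary i\<close> with i at most
    \<open>m xs\<close>; this is the source of the summand \<open>m xs\<close>.\<close>
  have b: "length (\<phi> i xs) \<le> (m xs + (2 + length (concat xs))) ^ d" if "length xs = n" "i \<le> m xs" for i xs
  proof -
    have "length (\<phi> i xs) \<le> (2 + length (concat (unary i # xs))) ^ d"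
      using d[of "unary i # xs"] f(2)[of "unary i # xs"] that by simp
    also have "\<dots> \<le> (m xs + (2 + length (concat xs))) ^ d"
      using that by (intro power_mono) auto
    finally show ?thesis .
  qed
  have eq: "rec_nat [] (\<lambda>i r. r @ \<phi> i xs) j = concat (map (\<lambda>i. \<phi> i xs) [0..<j])" for j xs
    by (induction j) auto
  have "pt n (\<lambda>xs. rec_nat [] (\<lambda>i r. r @ \<phi> i xs) (m xs))"
  proof (rule pt_rec_nat[where h = "\<lambda>i r xs. r @ \<phi> i xs" and g = "\<lambda>_. []", OF m])
    show "pt n (\<lambda>xs. unary (m xs * (m xs + (2 + length (concat xs))) ^ d))"
      by (intro pt_unary ptn_times m ptn_power_size)
    have "pt (Suc (Suc n)) (\<lambda>zs. \<phi> (length (hd zs)) (tl (tl zs)))"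
      using pt_shift_body[of n "\<lambda>w. \<phi> (length w)"] \<phi> by simp
    then show "pt (Suc (Suc n)) (\<lambda>zs. hd (tl zs) @ \<phi> (length (hd zs)) (tl (tl zs)))"
      by (intro pt_append pt_basic) auto
    show "length (rec_nat [] (\<lambda>i r. r @ \<phi> i xs) i)
        \<le> length (unary (m xs * (m xs + (2 + length (concat xs))) ^ d))"
      if "length xs = n" "i \<le> m xs" for xs i
    proof -
      have "sum_list (map (\<lambda>i. length (\<phi> i xs)) [0..<i])
          \<le> sum_list (map (\<lambda>_. (m xs + (2 + length (concat xs))) ^ d) [0..<i])"
        by (rule sum_list_mono) (use b that in auto)
      also have "\<dots> \<le> m xs * (m xs + (2 + length (concat xs))) ^ d"
        using that by (simp add: sum_list_triv)
      finally show ?thesis by (simp add: eq length_concat o_def)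
    qed
  qed (rule pt_nil)
  then show ?thesis by (simp add: eq)
qed

lemma pt_map_upt:
  "ptn n m \<Longrightarrow> ptb (Suc n) (\<lambda>zs. P (length (hd zs)) (tl zs)) \<Longrightarrow> pt n (\<lambda>xs. map (\<lambda>i. P i xs) [0..<m xs])"
  using pt_concat_upt[of n m "\<lambda>i xs. [P i xs]"] by (simp add: ptb_def concat_map_singleton)

lemma ptn_length_filter_upt:
  assumes "ptn n m" "ptb (Suc n) (\<lambda>zs. P (length (hd zs)) (tl zs))"
  shows "ptn n (\<lambda>xs. length (filter (\<lambda>i. P i xs) [0..<m xs]))"
proof -
  have "pt (Suc n) (\<lambda>zs. if P (length (hd zs)) (tl zs) then [True] else [])"
    using assms(2) by (intro pt_if pt_const)
  from ptn_length[OF pt_concat_upt[OF assms(1), of "\<lambda>i xs. if P i xs then [True] else []", OF this]]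
  have "ptn n (\<lambda>xs. length (concat (map (\<lambda>i. if P i xs then [True] else []) [0..<m xs])))" .
  moreover have "length (concat (map (\<lambda>i. if Q i then [True] else []) is)) = length (filter Q is)"
    for Q and "is" :: "nat list"
    by (induction "is") auto
  ultimately show ?thesis by simp
qed

lemma ptb_ex:
  assumes "ptn n m" "ptb (Suc n) (\<lambda>zs. P (length (hd zs)) (tl zs))"
  shows "ptb n (\<lambda>xs. \<exists>i<m xs. P i xs)"
  using ptb_less[OF ptn_const[of n 0] ptn_length_filter_upt[OF assms]]
  by (rule ptb_cong) (auto simp: filter_empty_conv)

lemma ptb_all:
  assumes "ptn n m" "ptb (Suc n) (\<lambda>zs. P (length (hd zs)) (tl zs))"
  shows "ptb n (\<lambda>xs. \<forall>i<m xs. P i xs)"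
  using ptb_not[OF ptb_ex[OF assms(1), of "\<lambda>i xs. \<not> P i xs", OF ptb_not[OF assms(2)]]]
  by (rule ptb_cong) auto

lemma ptn_mod: "ptn n a \<Longrightarrow> ptn n b \<Longrightarrow> ptn n (\<lambda>xs. a xs mod b xs)"
proof -
  assume ab: "ptn n a" "ptn n b"
  \<comment> \<open>A counter that wraps at q. For q = 0 it never wraps, in agreement with
    \<open>p mod 0 = p\<close>.\<close>
  have eq: "rec_nat [] (\<lambda>i r. unary (if Suc (length r) = q then 0 else Suc (length r))) p = unary (p mod q)"
    for p q by (induction p) (auto simp: mod_Suc unary_def)
  have "pt 2 (\<lambda>xs. rec_nat [] (\<lambda>i r. unary (if Suc (length r) = length (xs ! 1) then 0 else Suc (length r)))
      (length (xs ! 0)))"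
    by (rule pt_rec_nat[where k = "\<lambda>xs. xs ! 0"])
      ((intro pt_basic ptn_length pt_unary ptn_if ptb_eq ptn_Suc ptn_const; simp)+,
        auto simp: eq intro: le_trans[OF mod_less_eq_dividend])
  from pt_lift2[OF this, of n "\<lambda>xs. unary (a xs)" "\<lambda>xs. unary (b xs)"] ab
  show ?thesis by (simp add: eq ptn_def)
qed

lemma ptb_odd: "ptn n a \<Longrightarrow> ptb n (\<lambda>xs. odd (a xs))"
  by (rule ptb_cong[OF ptb_eq[OF ptn_mod[OF _ ptn_const[of n 2]] ptn_const[of n 1]]])
    (auto simp: odd_iff_mod_2_eq_one)

lemma ptn_div2: "ptn n a \<Longrightarrow> ptn n (\<lambda>xs. a xs div 2)"
proof -
  assume a: "ptn n a"
  have eq: "length (filter odd [0..<m]) = m div 2" for m :: nat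
    by (induction m) auto
  have "ptn n (\<lambda>xs. length (filter (\<lambda>i. odd i) [0..<a xs]))"
    by (intro ptn_length_filter_upt a ptb_odd ptn_length pt_basic) simp
  then show ?thesis by (simp add: eq)
qed

lemmas pt_rules = pt_basic pt_append pt_drop pt_unary pt_Cons pt_if pt_concat_upt pt_map_upt
  ptn_length ptn_const ptn_Suc ptn_plus ptn_times ptn_minus ptn_if ptn_mod ptn_div2 ptn_length_filter_upt
  ptb_const ptb_if ptb_not ptb_and ptb_iff ptb_less ptb_le ptb_eq ptb_nthb ptb_ex ptb_all ptb_odd

text \<open>Since a step never lengthens its word, the start word bounds all iterates.\<close>

lemma pt_funpow:
  assumes m: "ptn n m" and g: "pt n g" and f: "pt 1 (\<lambda>xs. f (hd xs))"
    and len: "\<And>w. length (f w) \<le> length w"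
  shows "pt n (\<lambda>xs. (f ^^ m xs) (g xs))"
proof -
  have eq: "rec_nat w (\<lambda>i. f) i = (f ^^ i) w" for w i
    by (induction i) auto
  have "length ((f ^^ i) w) \<le> length w" for i w
    by (induction i) (auto intro: le_trans[OF len])
  moreover have "pt (Suc (Suc n)) (\<lambda>zs. hd (tl zs))"
    by (intro pt_basic) simp
  from pt_lift1[OF f this] have "pt (Suc (Suc n)) (\<lambda>zs. f (hd (tl zs)))" by simp
  ultimately have "pt n (\<lambda>xs. rec_nat (g xs) (\<lambda>i r. f r) (m xs))"
    by (intro pt_rec_nat[OF m g _ g]) (simp_all add: eq)
  then show ?thesis by (simp add: eq)
qed

section \<open>Binary numerals\<close>

declare bin.simps [simp del]

lemma bin_0 [simp]: "bin 0 = []"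
  by (subst bin.simps) simp

lemma bin_eq_Nil_iff: "bin n = [] \<longleftrightarrow> n = 0"
  by (subst bin.simps) simp

text \<open>Binary codes of variables are never decoded: the code of a candidate is computed and
  compared, which is sound by injectivity.\<close>

lemma bin_inject: "bin m = bin n \<longleftrightarrow> m = n"
proof
  show "bin m = bin n \<Longrightarrow> m = n"
  proof (induction m arbitrary: n rule: less_induct)
    case (less m)
    show ?case
    proof (cases "m = 0 \<or> n = 0")
      case True
      then show ?thesis using less.prems bin_eq_Nil_iff by metis
    next
      case False
      then have "odd m = odd n" "bin (m div 2) = bin (n div 2)"
        using less.prems by (simp_all add: bin.simps[of m] bin.simps[of n])
      then show ?thesis using less.IH[of "m div 2" "n div 2"] False
        by (metis bot_nat_0.not_eq_extremum div_less_dividend even_two_times_div_two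
          odd_two_times_div_two_succ one_less_numeral_iff semiring_norm(76))
    qed
  qed
qed simp

text \<open>Bit i is the parity of the number halved i times, and bits are emitted only while the
  quotient is positive. As k is less than 2 to the power k, running i below k reaches every bit, so
  the loop length is the unary argument itself.\<close>

lemma pt_bin: "ptn n a \<Longrightarrow> pt n (\<lambda>xs. bin (a xs))"
proof -
  assume a: "ptn n a"
  define half where "half w = unary (length w div 2)" for w :: "bool list"
  have half: "(half ^^ i) (unary k) = unary (k div 2 ^ i)" for i k
    by (induction i) (auto simp: half_def div_mult2_eq mult.commute[of 2])
  have half_power: "l div 2 ^ Suc i = l div 2 div 2 ^ i" for l i :: nat
    by (simp add: div_mult2_eq)
  have eq: "bin k = concat (map (\<lambda>i. if 0 < k div 2 ^ i then [odd (k div 2 ^ i)] else []) [0..<m])"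
    if "k < 2 ^ m" for k m
    using that
  proof (induction m arbitrary: k)
    case (Suc m)
    then have "k div 2 < 2 ^ m" by auto
    from Suc.IH[OF this] show ?case
      by (subst bin.simps) (auto simp: upt_conv_Cons map_Suc_upt[symmetric] o_def half_power
        simp del: upt_Suc power_Suc cong: if_cong)
  qed simp
  have "pt 1 (\<lambda>xs. concat (map (\<lambda>i. if 0 < length ((half ^^ i) (unary (length (xs ! 0))))
      then [odd (length ((half ^^ i) (unary (length (xs ! 0)))))] else []) [0..<length (xs ! 0)]))"
    by (intro pt_rules pt_funpow; (simp add: half_def)?; (intro pt_rules)?; simp)
  from pt_lift1[OF this, of n "\<lambda>xs. unary (a xs)"] a
  show ?thesis by (simp add: half ptn_def eq[OF less_exp, symmetric] cong: if_cong)
qed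

subsection \<open>Sequences of words\<close>

definition ptl :: "nat \<Rightarrow> (bool list list \<Rightarrow> bool list list) \<Rightarrow> bool" where
  "ptl n f \<longleftrightarrow> pt n (\<lambda>xs. enc_seq (f xs))"

lemma enc_seq_simps [simp]:
  "enc_seq [] = []"
  "enc_seq (w # ws) = dbl w @ False # True # enc_seq ws"
  "enc_seq (us @ ws) = enc_seq us @ enc_seq ws"
  by (simp_all add: enc_seq_def)

lemma dbl_simps [simp]: "dbl [] = []" "dbl (b # w) = b # b # dbl w"
  by (simp_all add: dbl_def)

lemma length_dbl [simp]: "length (dbl w) = 2 * length w"
  by (induction w) auto

lemma pt_dbl: "pt n f \<Longrightarrow> pt n (\<lambda>xs. dbl (f xs))"
proof -
  assume f: "pt n f"
  have eq: "concat (map (\<lambda>i. [nthb w i, nthb w i]) [0..<length w]) = dbl w" for w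
  proof -
    have "map (\<lambda>i. [nthb w i, nthb w i]) [0..<length w] = map (\<lambda>b. [b, b]) w"
      by (rule nth_equalityI) (auto simp: nthb_def)
    then show ?thesis by (simp add: dbl_def)
  qed
  have "pt 1 (\<lambda>xs. concat (map (\<lambda>i. [nthb (xs ! 0) i, nthb (xs ! 0) i]) [0..<length (xs ! 0)]))"
    by (intro pt_rules; simp)
  from pt_lift1[OF this f] show ?thesis by (simp add: eq)
qed

lemma pt_enc_seq: "ptl n f \<Longrightarrow> pt n (\<lambda>xs. enc_seq (f xs))"
  by (simp add: ptl_def)

lemma ptl_const: "ptl n (\<lambda>_. c)"
  by (simp add: ptl_def pt_const)

lemma ptl_Cons: "pt n f \<Longrightarrow> ptl n g \<Longrightarrow> ptl n (\<lambda>xs. f xs # g xs)"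
  by (auto simp: ptl_def intro!: pt_append pt_dbl pt_Cons0)

lemma ptl_append: "ptl n f \<Longrightarrow> ptl n g \<Longrightarrow> ptl n (\<lambda>xs. f xs @ g xs)"
  by (auto simp: ptl_def intro!: pt_append)

lemma ptl_if: "ptb n P \<Longrightarrow> ptl n f \<Longrightarrow> ptl n g \<Longrightarrow> ptl n (\<lambda>xs. if P xs then f xs else g xs)"
  unfolding ptl_def using pt_if[of n P "\<lambda>xs. enc_seq (f xs)" "\<lambda>xs. enc_seq (g xs)"]
  by (simp add: if_distrib[of enc_seq])

lemma enc_seq_concat: "enc_seq (concat wss) = concat (map enc_seq wss)"
  by (induction wss) auto

lemma ptl_concat_upt:
  "ptn n m \<Longrightarrow> ptl (Suc n) (\<lambda>zs. \<phi> (length (hd zs)) (tl zs)) \<Longrightarrow>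
    ptl n (\<lambda>xs. concat (map (\<lambda>i. \<phi> i xs) [0..<m xs]))"
  unfolding ptl_def enc_seq_concat
  using pt_concat_upt[of n m "\<lambda>i xs. enc_seq (\<phi> i xs)"] by (simp add: o_def)

lemma ptl_map_upt:
  "ptn n m \<Longrightarrow> pt (Suc n) (\<lambda>zs. \<phi> (length (hd zs)) (tl zs)) \<Longrightarrow>
    ptl n (\<lambda>xs. map (\<lambda>i. \<phi> i xs) [0..<m xs])"
  using ptl_concat_upt[of n m "\<lambda>i xs. [\<phi> i xs]"]
  by (simp add: concat_map_singleton ptl_Cons ptl_const)

text \<open>The decoder \<open>dec\<close> for \<open>enc_seq\<close> is total; its values on words that are not
  encodings are irrelevant.\<close>

definition skip_pair :: "bool list \<Rightarrow> bool list" where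
  "skip_pair w = (if 1 < length w \<and> nthb w 0 = nthb w 1 then drop 2 w else w)"

text \<open>The separator is the first pair of unequal letters. \<open>skip_pair\<close> is
  stationary there, so iterating it as often as the word is long surely stops at the separator,
  which is then dropped.\<close>

definition tlw :: "bool list \<Rightarrow> bool list" where
  "tlw w = drop 2 ((skip_pair ^^ length w) w)"

text \<open>The consumed prefix has one pair per letter and one more pair for the separator, hence
  the \<open>- 1\<close>.\<close>

definition hdw :: "bool list \<Rightarrow> bool list" where
  "hdw w = map (\<lambda>i. nthb w (2 * i)) [0..<(length w - length (tlw w)) div 2 - 1]"

definition dec :: "bool list \<Rightarrow> bool list list" where
  "dec w = map (\<lambda>i. hdw ((tlw ^^ i) w)) [0..<length (filter (\<lambda>i. 0 < length ((tlw ^^ i) w)) [0..<length w])]"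

text \<open>The default \<open>[]\<close> keeps lookup total and plays the role of a zero row, in
  particular when there is no pivot.\<close>

definition wat :: "bool list list \<Rightarrow> nat \<Rightarrow> bool list" where
  "wat ws i = (if i < length ws then ws ! i else [])"

lemma skip_pair_simps [simp]:
  "skip_pair (b # b # w) = w" "skip_pair (False # True # w) = False # True # w"
  by (simp_all add: skip_pair_def nthb_def)

lemma tlw_code [simp]: "tlw (dbl v @ False # True # r) = r"
proof -
  have stop: "(skip_pair ^^ j) (False # True # r) = False # True # r" for j
    by (induction j) auto
  have "(skip_pair ^^ (length v + j)) (dbl v @ False # True # r) = False # True # r" for j
    by (induction v) (simp_all add: stop funpow_Suc_right del: funpow.simps(2))
  from this[of "length v + 2 + length r"] show ?thesis
    by (simp add: tlw_def mult_2 add.assoc)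
qed

lemma nthb_dbl: "i < length v \<Longrightarrow> nthb (dbl v @ r) (2 * i) = v ! i"
  by (induction v arbitrary: i) (auto simp: nthb_def nth_Cons split: nat.split)

lemma hdw_code [simp]: "hdw (dbl v @ False # True # r) = v"
  unfolding hdw_def by (rule nth_equalityI) (auto simp: nthb_dbl)

lemma tlw_funpow_enc_seq: "(tlw ^^ i) (enc_seq ws) = enc_seq (drop i ws)"
proof (induction i arbitrary: ws)
  case (Suc i)
  have "tlw (enc_seq ws) = enc_seq (tl ws)"
    by (cases ws) (simp_all add: tlw_def[of "[]"])
  then show ?case
    by (simp add: Suc.IH funpow_Suc_right drop_Suc del: funpow.simps(2))
qed simp

lemma length_enc_seq_ge: "2 * length ws \<le> length (enc_seq ws)"
  by (induction ws) auto

lemma enc_seq_eq_Nil_iff: "enc_seq ws = [] \<longleftrightarrow> ws = []"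
  by (cases ws) auto

text \<open>The number of words is recovered as the number of nonempty tails. Every word occupies at
  least two letters, so searching the indices below the length of the encoding finds all
  tails.\<close>

lemma dec_enc_seq [simp]: "dec (enc_seq ws) = ws"
proof -
  have "filter (\<lambda>i. 0 < length ((tlw ^^ i) (enc_seq ws))) [0..<length (enc_seq ws)]
      = filter (\<lambda>i. i < length ws) [0..<length (enc_seq ws)]"
    by (rule filter_cong) (auto simp: tlw_funpow_enc_seq enc_seq_eq_Nil_iff)
  moreover have "filter (\<lambda>i. i < k) [0..<l] = [0..<k]" if "k \<le> l" for k l :: nat
    using that by (induction l) (auto simp: le_Suc_eq)
  ultimately have num: "length (filter (\<lambda>i. 0 < length ((tlw ^^ i) (enc_seq ws))) [0..<length (enc_seq ws)]) = length ws"
    using length_enc_seq_ge[of ws] by simp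
  show ?thesis unfolding dec_def num
    by (rule nth_equalityI) (auto simp: tlw_funpow_enc_seq Cons_nth_drop_Suc[symmetric])
qed

lemma length_skip_pair_le: "length (skip_pair w) \<le> length w"
  by (simp add: skip_pair_def)

lemma length_tlw_le: "length (tlw w) \<le> length w"
proof -
  have "length ((skip_pair ^^ i) w) \<le> length w" for i
    by (induction i) (auto intro: le_trans[OF length_skip_pair_le])
  from this[of "length w"] show ?thesis by (simp add: tlw_def)
qed

lemma pt_skip_pair: "pt 1 (\<lambda>xs. skip_pair (hd xs))"
  unfolding skip_pair_def by (intro pt_rules; simp)

lemma pt_tlw: "pt n f \<Longrightarrow> pt n (\<lambda>xs. tlw (f xs))"
  unfolding tlw_def by (intro pt_rules pt_funpow pt_skip_pair length_skip_pair_le) auto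

lemma pt_tlw_funpow: "ptn n m \<Longrightarrow> pt n f \<Longrightarrow> pt n (\<lambda>xs. (tlw ^^ m xs) (f xs))"
  by (intro pt_funpow pt_tlw length_tlw_le pt_basic) auto

lemma pt_hdw: "pt n f \<Longrightarrow> pt n (\<lambda>xs. hdw (f xs))"
proof -
  assume f: "pt n f"
  have "pt 1 (\<lambda>xs. hdw (hd xs))"
    unfolding hdw_def by (intro pt_rules pt_tlw; simp)
  from pt_lift1[OF this f] show ?thesis by simp
qed

lemma ptl_dec: "pt n f \<Longrightarrow> ptl n (\<lambda>xs. dec (f xs))"
proof -
  assume f: "pt n f"
  have "ptl 1 (\<lambda>xs. dec (hd xs))"
    unfolding dec_def by (intro ptl_map_upt pt_rules pt_hdw pt_tlw_funpow; simp)
  from pt_lift1[OF this[unfolded ptl_def] f] show ?thesis by (simp add: ptl_def)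
qed

lemma ptn_length_list: "ptl n f \<Longrightarrow> ptn n (\<lambda>xs. length (f xs))"
proof -
  assume f: "ptl n f"
  have "pt 1 (\<lambda>xs. unary (length (filter (\<lambda>i. 0 < length ((tlw ^^ i) (hd xs))) [0..<length (hd xs)])))"
    by (intro pt_rules pt_tlw_funpow; simp)
  then have "pt 1 (\<lambda>xs. unary (length (dec (hd xs))))" by (simp add: dec_def)
  from pt_lift1[OF this f[unfolded ptl_def]] show ?thesis by (simp add: ptn_def)
qed

lemma pt_wat: "ptl n f \<Longrightarrow> ptn n i \<Longrightarrow> pt n (\<lambda>xs. wat (f xs) (i xs))"
proof -
  assume f: "ptl n f" and i: "ptn n i"
  have eq: "hdw ((tlw ^^ i) (enc_seq ws)) = wat ws i" for ws i
  proof (cases "i < length ws")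
    case False
    then show ?thesis by (simp add: tlw_funpow_enc_seq wat_def hdw_def)
  qed (simp add: tlw_funpow_enc_seq wat_def Cons_nth_drop_Suc[symmetric])
  have "pt n (\<lambda>xs. hdw ((tlw ^^ i xs) (enc_seq (f xs))))"
    by (intro pt_hdw pt_tlw_funpow i pt_enc_seq f)
  then show ?thesis by (simp add: eq)
qed

lemma pt_concat_map:
  assumes L: "ptl n L" and \<phi>: "pt (Suc n) (\<lambda>zs. \<phi> (hd zs) (tl zs))"
  shows "pt n (\<lambda>xs. concat (map (\<lambda>w. \<phi> w xs) (L xs)))"
proof -
  have "pt (Suc n) (\<lambda>zs. enc_seq (L (tl zs)))"
    using pt_shift[of n "\<lambda>xs. enc_seq (L xs)"] L by (simp add: ptl_def)
  then have "pt (Suc n) (\<lambda>zs. wat (L (tl zs)) (length (hd zs)))"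
    by (intro pt_wat pt_rules) (auto simp: ptl_def)
  from pt_let[of "Suc n" "\<lambda>w zs. \<phi> w (tl zs)", OF pt_shift_body[of n \<phi>, OF \<phi>] this]
  have "pt n (\<lambda>xs. concat (map (\<lambda>i. \<phi> (wat (L xs) i) xs) [0..<length (L xs)]))"
    by (intro pt_concat_upt ptn_length_list L)
  moreover have "map (\<lambda>i. \<phi> (wat (L xs) i) xs) [0..<length (L xs)] = map (\<lambda>w. \<phi> w xs) (L xs)" for xs
    by (rule nth_equalityI) (auto simp: wat_def)
  ultimately show ?thesis by simp
qed

lemma ptl_concat_map:
  "ptl n L \<Longrightarrow> ptl (Suc n) (\<lambda>zs. \<phi> (hd zs) (tl zs)) \<Longrightarrow> ptl n (\<lambda>xs. concat (map (\<lambda>w. \<phi> w xs) (L xs)))"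
  using pt_concat_map[of n L "\<lambda>w xs. enc_seq (\<phi> w xs)"] by (simp add: ptl_def enc_seq_concat o_def)

lemma ptl_map:
  "ptl n L \<Longrightarrow> pt (Suc n) (\<lambda>zs. \<phi> (hd zs) (tl zs)) \<Longrightarrow> ptl n (\<lambda>xs. map (\<lambda>w. \<phi> w xs) (L xs))"
  using ptl_concat_map[of n L "\<lambda>w xs. [\<phi> w xs]"] by (simp add: concat_map_singleton ptl_Cons ptl_const)

lemma ptl_filter:
  assumes L: "ptl n L" and P: "ptb (Suc n) (\<lambda>zs. P (hd zs) (tl zs))"
  shows "ptl n (\<lambda>xs. filter (\<lambda>w. P w xs) (L xs))"
proof -
  have "ptl n (\<lambda>xs. concat (map (\<lambda>w. if P w xs then [w] else []) (L xs)))"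
    by (intro ptl_concat_map L ptl_if P ptl_Cons ptl_const pt_basic) simp
  moreover have "concat (map (\<lambda>w. if Q w then [w] else []) ws) = filter Q ws" for Q and ws :: "bool list list"
    by (induction ws) auto
  ultimately show ?thesis by simp
qed

text \<open>The accumulator is the encoded list, decoded and encoded again in each round; therefore
  the condition of not growing is about \<open>enc_seq\<close>.\<close>

lemma ptl_funpow:
  assumes m: "ptn n m" and g: "ptl n g" and f: "ptl 1 (\<lambda>xs. f (dec (hd xs)))"
    and len: "\<And>ws. length (enc_seq (f ws)) \<le> length (enc_seq ws)"
  shows "ptl n (\<lambda>xs. (f ^^ m xs) (g xs))"
proof -
  have eq: "rec_nat (enc_seq ws) (\<lambda>i r. enc_seq (f (dec r))) i = enc_seq ((f ^^ i) ws)" for ws i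
    by (induction i) auto
  have "length (enc_seq ((f ^^ i) ws)) \<le> length (enc_seq ws)" for i ws
    by (induction i) (auto intro: le_trans[OF len])
  moreover have "pt (Suc (Suc n)) (\<lambda>zs. hd (tl zs))"
    by (intro pt_basic) simp
  from pt_lift1[OF f[unfolded ptl_def] this]
  have "pt (Suc (Suc n)) (\<lambda>zs. enc_seq (f (dec (hd (tl zs)))))" by simp
  ultimately have "pt n (\<lambda>xs. rec_nat (enc_seq (g xs)) (\<lambda>i r. enc_seq (f (dec r))) (m xs))"
    using g by (intro pt_rec_nat[OF m, where k = "\<lambda>xs. enc_seq (g xs)"]) (simp_all add: eq ptl_def)
  then show ?thesis by (simp add: eq ptl_def)
qed

lemma ptb_word_eq: "pt n f \<Longrightarrow> pt n g \<Longrightarrow> ptb n (\<lambda>xs. f xs = g xs)"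
proof -
  assume fg: "pt n f" "pt n g"
  have "ptb 2 (\<lambda>xs. length (xs ! 0) = length (xs ! 1) \<and>
      (\<forall>i<length (xs ! 0). nthb (xs ! 0) i = nthb (xs ! 1) i))"
    by (intro pt_rules; simp)
  then have "pt 2 (\<lambda>xs. [xs ! 0 = xs ! 1])"
    unfolding ptb_def by (rule pt_cong) (auto simp: nthb_def list_eq_iff_nth_eq)
  from pt_lift2[OF this fg] show ?thesis by (simp add: ptb_def)
qed

lemmas ptl_rules = pt_rules pt_bin pt_enc_seq pt_wat pt_concat_map ptl_const ptl_Cons ptl_append ptl_if
  ptl_concat_upt ptl_map_upt ptl_dec ptn_length_list ptl_concat_map ptl_map ptl_filter ptb_word_eq

subsection \<open>Linear algebra over GF(2)\<close>

declare add_bit_eq_xor [simp del] mult_bit_eq_and [simp del]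

lemma bit_add_self [simp]: "a + a = (0 :: bit)"
  by (cases a) simp_all

lemma bit_add_eq_0_iff: "a + b = (0 :: bit) \<longleftrightarrow> a = b"
  by (cases a; cases b) simp_all

lemma of_bool_neq_bit: "of_bool (P \<noteq> Q) = (of_bool P + of_bool Q :: bit)"
  by (cases P; cases Q) simp_all

lemma of_bool_odd_card:
  fixes n :: nat
  shows "of_bool (odd (card {j. j < n \<and> P j})) = (\<Sum>j<n. of_bool (P j) :: bit)"
proof (induction n)
  case (Suc n)
  have "{j. j < Suc n \<and> P j} = (if P n then insert n {j. j < n \<and> P j} else {j. j < n \<and> P j})"
    by (auto simp: less_Suc_eq)
  moreover have "of_bool (odd (Suc k)) = (of_bool (odd k) + 1 :: bit)" for k
    by (cases "odd k") simp_all
  ultimately show ?case using Suc by (cases "P n") simp_all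
qed simp

lemma sum_mult_delta:
  fixes m :: nat
  shows "(\<Sum>i<m. c i * of_bool (q = i)) = (if q < m then c q else (0 :: bit))"
proof -
  have "(\<Sum>i<m. c i * of_bool (q = i)) = (\<Sum>i<m. if q = i then c i else 0)"
    by (intro sum.cong) auto
  then show ?thesis by simp
qed

section \<open>Row spaces and Gaussian elimination\<close>

definition bv :: "bool list \<Rightarrow> nat \<Rightarrow> bit" where
  "bv w i = of_bool (nthb w i)"

lemma nthb_map_upt [simp]: "nthb (map f [0..<n]) i \<longleftrightarrow> i < n \<and> f i"
  by (auto simp: nthb_def)

lemma nthb_Nil [simp]: "\<not> nthb [] i"
  by (simp add: nthb_def)

lemma nthb_append: "nthb (u @ v) i = (if i < length u then nthb u i else nthb v (i - length u))"
  by (auto simp: nthb_def nth_append)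

lemma nthb_Cons: "nthb (b # w) i = (case i of 0 \<Rightarrow> b | Suc j \<Rightarrow> nthb w j)"
  by (cases i) (auto simp: nthb_def)

lemma bv_ge_length: "length w \<le> i \<Longrightarrow> bv w i = 0"
  by (simp add: bv_def nthb_def)

text \<open>The row space of V. Its vectors are functions on all of \<open>nat\<close>, so that
  lists of different widths can be compared.\<close>

definition Lin :: "bool list list \<Rightarrow> (nat \<Rightarrow> bit) \<Rightarrow> bool" where
  "Lin V f \<longleftrightarrow> (\<exists>c. \<forall>q. f q = (\<Sum>i<length V. c i * bv (V ! i) q))"

lemma Lin_member: "v \<in> set V \<Longrightarrow> Lin V (bv v)"
proof -
  assume "v \<in> set V"
  then obtain k where "k < length V" "v = V ! k" by (auto simp: in_set_conv_nth)
  then have "\<forall>q. bv v q = (\<Sum>i<length V. of_bool (k = i) * bv (V ! i) q)"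
    by (simp add: mult.commute[of "of_bool _"] sum_mult_delta)
  then show ?thesis unfolding Lin_def by (rule exI[of _ "\<lambda>i. of_bool (k = i)"])
qed

definition pivot :: "bool list list \<Rightarrow> bool list" where
  "pivot V = wat (filter (\<lambda>v. nthb v 0) V) 0"

lemma pivot_in_set: "v \<in> set V \<Longrightarrow> nthb v 0 \<Longrightarrow> pivot V \<in> set V \<and> nthb (pivot V) 0"
proof -
  assume "v \<in> set V" "nthb v 0"
  then have "0 < length (filter (\<lambda>v. nthb v 0) V)"
    by (auto simp: filter_empty_conv)
  then have "pivot V \<in> set (filter (\<lambda>v. nthb v 0) V)"
    unfolding pivot_def wat_def by (simp only: if_True nth_mem)
  then show ?thesis by auto
qed

lemma pivot_Nil: "(\<And>v. v \<in> set V \<Longrightarrow> \<not> nthb v 0) \<Longrightarrow> pivot V = []"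
  by (simp add: pivot_def wat_def filter_False)

text \<open>The pivot is added to every row with leading entry 1, itself included: it becomes a zero
  row instead of being removed, and the row indices stay fixed. Without a pivot only the leading
  column disappears.\<close>

definition elim_step :: "bool list list \<Rightarrow> bool list list" where
  "elim_step V = map (\<lambda>v. map (\<lambda>q. nthb v (Suc q) \<noteq> (nthb v 0 \<and> nthb (pivot V) (Suc q))) [0..<length v - 1]) V"

lemma length_elim_step [simp]: "length (elim_step V) = length V"
  by (simp add: elim_step_def)

lemma bv_elim_step:
  assumes "\<forall>v\<in>set V. length v = l" "i < length V"
  shows "bv (elim_step V ! i) q = bv (V ! i) (Suc q) + bv (V ! i) 0 * bv (pivot V) (Suc q)"
proof (cases "q < l - 1")
  case True
  then show ?thesis using assms by (auto simp: elim_step_def bv_def of_bool_neq_bit of_bool_conj)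
next
  case False
  have "length (pivot V) \<le> l"
    using assms pivot_in_set[of _ V] pivot_Nil[of V] by (metis bot_nat_0.extremum eq_imp_le list.size(3))
  then show ?thesis using False assms
    by (simp add: bv_ge_length) (simp add: elim_step_def bv_def)
qed

text \<open>Combining the new rows with coefficients c means combining the old ones and adding s
  times the pivot, where s is the leading entry of the old combination (\<open>step\<close>). If s =
  0 nothing is added. Conversely, s additional copies of the pivot are exactly what clears the
  leading entry.\<close>

lemma Lin_elim_step:
  assumes V: "\<forall>v\<in>set V. length v = l"
  shows "Lin (elim_step V) f \<longleftrightarrow> Lin V (case_nat 0 f)"
proof
  let ?n = "length V"
  let ?p = "pivot V"
  have step: "(\<Sum>i<?n. c i * bv (elim_step V ! i) q)
      = (\<Sum>i<?n. c i * bv (V ! i) (Suc q)) + (\<Sum>i<?n. c i * bv (V ! i) 0) * bv ?p (Suc q)" for c q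
    by (simp add: bv_elim_step[OF V] distrib_left sum.distrib sum_distrib_right mult.assoc)
  {
    assume "Lin V (case_nat 0 f)"
    then obtain c where c: "\<And>q. case_nat 0 f q = (\<Sum>i<?n. c i * bv (V ! i) q)"
      unfolding Lin_def by blast
    have "f q = (\<Sum>i<?n. c i * bv (elim_step V ! i) q)" for q
      using c[of 0] c[of "Suc q"] by (simp add: step flip: c)
    then show "Lin (elim_step V) f" unfolding Lin_def by auto
  next
    assume "Lin (elim_step V) f"
    then obtain c where c: "\<And>q. f q = (\<Sum>i<?n. c i * bv (elim_step V ! i) q)"
      unfolding Lin_def by auto
    define s where "s = (\<Sum>i<?n. c i * bv (V ! i) 0)"
    show "Lin V (case_nat 0 f)"
    proof (cases "\<exists>v\<in>set V. nthb v 0")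
      case True
      then have "pivot V \<in> set V" and p: "nthb ?p 0" using pivot_in_set by blast+
      then obtain k where k: "k < ?n" "?p = V ! k" by (auto simp: in_set_conv_nth)
      have p1: "bv ?p 0 = 1" using p by (simp add: bv_def)
      have "case_nat 0 f q = (\<Sum>i<?n. (c i + s * of_bool (k = i)) * bv (V ! i) q)" for q
      proof -
        have "(\<Sum>i<?n. (c i + s * of_bool (k = i)) * bv (V ! i) q)
            = (\<Sum>i<?n. c i * bv (V ! i) q) + (\<Sum>i<?n. (s * bv (V ! i) q) * of_bool (k = i))"
          by (simp add: distrib_right sum.distrib mult.assoc mult.commute[of "of_bool _"])
        also have "\<dots> = (\<Sum>i<?n. c i * bv (V ! i) q) + s * bv ?p q"
          using k by (simp only: sum_mult_delta if_True)
        also have "\<dots> = case_nat 0 f q"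
          using p1 by (cases q) (simp_all add: c step s_def)
        finally show ?thesis by simp
      qed
      then show ?thesis unfolding Lin_def
        by (intro exI[of _ "\<lambda>i. c i + s * of_bool (k = i)"] allI)
    next
      case False
      then have "s = 0" unfolding s_def by (intro sum.neutral) (auto simp: bv_def)
      have "case_nat 0 f q = (\<Sum>i<?n. c i * bv (V ! i) q)" for q
        using \<open>s = 0\<close> by (cases q) (auto simp: c step s_def[symmetric])
      then show ?thesis unfolding Lin_def by blast
    qed
  }
qed

lemma elim_step_lengths: "\<forall>v\<in>set V. length v = l \<Longrightarrow> \<forall>v\<in>set ((elim_step ^^ k) V). length v = l - k"
  by (induction k) (auto simp: elim_step_def)

lemma length_funpow_elim_step [simp]: "length ((elim_step ^^ k) V) = length V"
  by (induction k) auto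

lemma Lin_funpow_elim_step:
  assumes V: "\<forall>v\<in>set V. length v = l"
  shows "Lin ((elim_step ^^ k) V) f \<longleftrightarrow> Lin V (\<lambda>q. if q < k then 0 else f (q - k))"
proof (induction k arbitrary: f)
  case (Suc k)
  have "(\<lambda>q. if q < k then 0 else case_nat 0 f (q - k)) = (\<lambda>q. if q < Suc k then 0 else f (q - Suc k))"
    by (auto simp: fun_eq_iff split: nat.split) (metis Suc_diff_Suc diff_is_0_eq' le_neq_implies_less
      less_Suc_eq_le nat.inject not_less zero_less_diff)+
  then show ?case using Lin_elim_step[OF elim_step_lengths[OF V]] Suc by simp
qed simp

section \<open>Elimination as a polynomial-time procedure, and solving linear systems\<close>

lemma length_enc_seq: "length (enc_seq ws) = (\<Sum>w\<leftarrow>ws. 2 * length w + 2)"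
  by (induction ws) auto

lemma length_enc_elim_step: "length (enc_seq (elim_step V)) \<le> length (enc_seq V)"
  unfolding length_enc_seq elim_step_def by (simp add: o_def) (rule sum_list_mono, simp)

lemma pt_pivot: "ptl n f \<Longrightarrow> pt n (\<lambda>xs. pivot (f xs))"
proof -
  assume f: "ptl n f"
  have "pt 1 (\<lambda>xs. pivot (dec (hd xs)))"
    unfolding pivot_def by (intro ptl_rules; simp)
  from pt_lift1[OF this f[unfolded ptl_def]] show ?thesis by simp
qed

lemma ptl_funpow_elim_step: "ptn n m \<Longrightarrow> ptl n f \<Longrightarrow> ptl n (\<lambda>xs. (elim_step ^^ m xs) (f xs))"
proof (erule ptl_funpow, assumption)
  show "ptl 1 (\<lambda>xs. elim_step (dec (hd xs)))"
    unfolding elim_step_def by (intro ptl_rules pt_pivot; simp)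
qed (rule length_enc_elim_step)

text \<open>The rows are the columns of A, each followed by marker 0 and a unit vector, and finally
  b, followed by marker 1 and zeros. After eliminating the equation coordinates, a row with leading
  marker 1 is a vanishing sum of b and some columns; the unit vectors have recorded which ones. An
  unsolvable system still yields a word of length n, so callers check the result where this can
  happen.\<close>

definition solve :: "nat \<Rightarrow> bool list list \<Rightarrow> bool list \<Rightarrow> bool list" where
  "solve n A b = map (\<lambda>q. nthb (pivot ((elim_step ^^ length A)
     (map (\<lambda>j. map (\<lambda>i. if j < n then nthb (wat A i) j else nthb b i) [0..<length A] @
        (j = n) # map (\<lambda>q. q = j) [0..<n]) [0..<Suc n]))) (Suc q)) [0..<n]"

lemma length_solve [simp]: "length (solve n A b) = n"
  by (simp add: solve_def)

lemma pt_solve: "ptn n k \<Longrightarrow> ptl n A \<Longrightarrow> pt n b \<Longrightarrow> pt n (\<lambda>xs. solve (k xs) (A xs) (b xs))"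
proof -
  assume kAb: "ptn n k" "ptl n A" "pt n b"
  have "pt 3 (\<lambda>xs. solve (length (xs ! 0)) (dec (xs ! 1)) (xs ! 2))"
    unfolding solve_def by (intro ptl_rules pt_pivot ptl_funpow_elim_step; simp)
  from pt_lift3[OF this kAb[unfolded ptn_def ptl_def]] show ?thesis by simp
qed

lemma wat_nth [simp]: "i < length A \<Longrightarrow> wat A i = A ! i"
  by (simp add: wat_def)

lemma solve_correct:
  assumes ex: "\<exists>x. \<forall>i<length A. (\<Sum>j<n. bv (A ! i) j * x j) = bv b i"
    and i: "i < length A"
  shows "(\<Sum>j<n. bv (A ! i) j * bv (solve n A b) j) = bv b i"
proof -
  let ?m = "length A"
  define W where "W = map (\<lambda>j. map (\<lambda>i. if j < n then nthb (wat A i) j else nthb b i) [0..<?m] @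
        (j = n) # map (\<lambda>q. q = j) [0..<n]) [0..<Suc n]"
  define V where "V = (elim_step ^^ ?m) W"
  have W_len: "length W = Suc n" "\<forall>v\<in>set W. length v = ?m + Suc n"
    by (auto simp: W_def)
  have W_nth: "bv (W ! j) q = (if q < ?m then if j < n then bv (A ! q) j else bv b q
      else if q = ?m then of_bool (j = n) else of_bool (q - Suc ?m < n \<and> q - Suc ?m = j))"
    if "j < Suc n" for j q
  proof -
    have "W ! j = map (\<lambda>i. if j < n then nthb (wat A i) j else nthb b i) [0..<?m] @
        (j = n) # map (\<lambda>q. q = j) [0..<n]"
      using that unfolding W_def by (simp del: upt_Suc)
    moreover have "q - ?m = Suc (q - Suc ?m)" if "\<not> q < ?m" "q \<noteq> ?m"
      using that by simp
    ultimately show ?thesis by (auto simp: bv_def nthb_append nthb_Cons split: nat.split)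
  qed
  have LinV: "Lin V f \<longleftrightarrow> Lin W (\<lambda>q. if q < ?m then 0 else f (q - ?m))" for f
    unfolding V_def by (rule Lin_funpow_elim_step[OF W_len(2)])
  obtain x where x: "\<And>i. i < ?m \<Longrightarrow> (\<Sum>j<n. bv (A ! i) j * x j) = bv b i"
    using ex by blast
  \<comment> \<open>The solution x, together with coefficient 1 for b, makes all equation
    coordinates vanish; f is the part that remains, namely the marker 1 followed by x.\<close>
  define c where "c j = (if j < n then x j else 1)" for j
  define f where "f q = (case q of 0 \<Rightarrow> 1 | Suc p \<Rightarrow> if p < n then x p else 0)" for q
  have "(if q < ?m then 0 else f (q - ?m)) = (\<Sum>j<Suc n. c j * bv (W ! j) q)" for q
  proof -
    consider "q < ?m" | "q = ?m" | "q > ?m" by linarith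
    then show ?thesis
    proof cases
      case 1
      have "(\<Sum>j<n. c j * bv (W ! j) q) = (\<Sum>j<n. bv (A ! q) j * x j)"
        using 1 by (intro sum.cong) (auto simp: W_nth c_def)
      then show ?thesis using 1 x by (simp add: W_nth c_def)
    next
      case 2
      have "(\<Sum>j<n. c j * bv (W ! j) q) = 0"
        using 2 by (intro sum.neutral) (auto simp: W_nth)
      then show ?thesis using 2 by (simp add: W_nth f_def c_def)
    next
      case 3
      then obtain p where p: "q = Suc (?m + p)" by (auto dest: less_imp_Suc_add)
      have "(\<Sum>j<n. c j * bv (W ! j) q) = (\<Sum>j<n. c j * of_bool (p = j))"
        by (intro sum.cong) (auto simp: W_nth p)
      then show ?thesis by (auto simp: W_nth p f_def c_def sum_mult_delta)
    qed
  qed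
  then have "Lin V f" unfolding LinV unfolding Lin_def W_len by blast
  then obtain d where d: "\<And>q. f q = (\<Sum>i<length V. d i * bv (V ! i) q)"
    unfolding Lin_def by blast
  \<comment> \<open>f has leading entry 1 and is a combination of the rows of V, so they cannot all
    begin with 0.\<close>
  have "\<exists>v\<in>set V. nthb v 0"
  proof (rule ccontr)
    assume "\<not> (\<exists>v\<in>set V. nthb v 0)"
    then have "f 0 = 0" unfolding d by (intro sum.neutral) (auto simp: bv_def)
    then show False by (simp add: f_def)
  qed
  then have p: "pivot V \<in> set V" "nthb (pivot V) 0" using pivot_in_set by blast+
  obtain e where e: "\<And>q. (if q < ?m then 0 else bv (pivot V) (q - ?m)) = (\<Sum>j<Suc n. e j * bv (W ! j) q)"
    using Lin_member[OF p(1)] unfolding LinV unfolding Lin_def W_len by blast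
  \<comment> \<open>Coordinate \<open>?m\<close> is the marker, which only the row of b carries; b
    therefore takes part in the combination found.\<close>
  have "e n = 1"
  proof -
    have "(\<Sum>j<n. e j * bv (W ! j) ?m) = 0"
      by (intro sum.neutral) (auto simp: W_nth)
    then show ?thesis using e[of ?m] p(2) by (simp add: W_nth bv_def[of "pivot V"])
  qed
  have sol: "bv (solve n A b) k = e k" if "k < n" for k
  proof -
    have "(\<Sum>j<n. e j * bv (W ! j) (Suc (?m + k))) = (\<Sum>j<n. e j * of_bool (k = j))"
      by (intro sum.cong) (auto simp: W_nth that)
    then have "bv (pivot V) (Suc k) = e k"
      using e[of "Suc (?m + k)"] that by (simp add: W_nth sum_mult_delta)
    then show ?thesis using that
      by (simp add: solve_def bv_def V_def W_def del: upt_Suc)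
  qed
  have "(\<Sum>j<n. e j * bv (W ! j) i) = (\<Sum>j<n. bv (A ! i) j * bv (solve n A b) j)"
    using i by (intro sum.cong) (auto simp: W_nth sol)
  then show ?thesis using e[of i] i \<open>e n = 1\<close> by (simp add: W_nth bit_add_eq_0_iff)
qed

text \<open>Induction on the columns. Setting the last unknown to 0 or 1 leaves systems with
  right-hand sides y and y plus the last column. If both fail, they have certificates h1 and h2. A
  certificate orthogonal to the last column serves as it is; if neither is orthogonal, then h2 y =
  0, and h1 + h2 is orthogonal to the last column and still has value 1 on y.\<close>

lemma fredholm_alternative:
  fixes a :: "nat \<Rightarrow> nat \<Rightarrow> bit"
  shows "(\<exists>x. \<forall>i<m. (\<Sum>j<n. a i j * x j) = y i) \<or>
    (\<exists>h. (\<forall>j<n. (\<Sum>i<m. h i * a i j) = 0) \<and> (\<Sum>i<m. h i * y i) = 1)"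
proof (induction n arbitrary: y)
  case 0
  show ?case
  proof (cases "\<forall>i<m. y i = 0")
    case False
    then obtain k where k: "k < m" "y k = 1" by auto
    have "(\<Sum>i<m. of_bool (k = i) * y i) = 1"
      using k by (simp add: mult.commute[of "of_bool _"] sum_mult_delta)
    then show ?thesis by (intro disjI2 exI[of _ "\<lambda>i. of_bool (k = i)"]) simp
  qed simp
next
  case (Suc n)
  have ext: "\<exists>x. \<forall>i<m. (\<Sum>j<Suc n. a i j * x j) = y i"
    if "\<forall>i<m. (\<Sum>j<n. a i j * x j) = y i + t * a i n" for x t
  proof (intro exI[of _ "\<lambda>j. if j < n then x j else t"] allI impI)
    fix i assume "i < m"
    have "(\<Sum>j<n. a i j * (if j < n then x j else t)) = (\<Sum>j<n. a i j * x j)"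
      by (intro sum.cong) auto
    then show "(\<Sum>j<Suc n. a i j * (if j < n then x j else t)) = y i"
      using that \<open>i < m\<close> by (simp add: mult.commute add.assoc)
  qed
  show ?case
  proof (cases "\<exists>x t. \<forall>i<m. (\<Sum>j<n. a i j * x j) = y i + t * a i n")
    case True
    then show ?thesis using ext by blast
  next
    case False
    then have no: "\<not> (\<exists>x. \<forall>i<m. (\<Sum>j<n. a i j * x j) = y i + t * a i n)" for t
      by blast
    obtain h1 where h1: "\<forall>j<n. (\<Sum>i<m. h1 i * a i j) = 0" "(\<Sum>i<m. h1 i * y i) = 1"
      using Suc[of y] no[of 0] unfolding mult_zero_left add_0_right by blast
    obtain h2 where h2: "\<forall>j<n. (\<Sum>i<m. h2 i * a i j) = 0" "(\<Sum>i<m. h2 i * (y i + a i n)) = 1"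
      using Suc[of "\<lambda>i. y i + a i n"] no[of 1] unfolding mult_1 by blast
    note dual = h1 h2
    have eq2: "(\<Sum>i<m. h2 i * y i) + (\<Sum>i<m. h2 i * a i n) = 1"
      using dual(4) by (simp add: distrib_left sum.distrib)
    have *: ?thesis if "\<forall>j<n. (\<Sum>i<m. h i * a i j) = 0" "(\<Sum>i<m. h i * a i n) = 0" "(\<Sum>i<m. h i * y i) = 1" for h
      using that by (intro disjI2 exI[of _ h]) (auto simp: less_Suc_eq)
    show ?thesis
    proof (cases "(\<Sum>i<m. h1 i * a i n) = 0 \<or> (\<Sum>i<m. h2 i * a i n) = 0")
      case True
      then show ?thesis using dual eq2 *[of h1] *[of h2] by auto
    next
      case False
      then show ?thesis using dual eq2
        by (intro *[of "\<lambda>i. h1 i + h2 i"]) (auto simp: distrib_right sum.distrib)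
    qed
  qed
qed

text \<open>The affine space b + im A consists of the T with h T = h b for all h in the left kernel
  of A. Odd Set only has equations with right-hand side 1, so a fixed h with h b = 1 is
  added to those with h b = 0. If there is no such h, then b lies in im A and the optimum is 0,
  which is expressed by the empty set system.\<close>

definition parity_sets :: "nat \<Rightarrow> bool list list \<Rightarrow> bool list \<Rightarrow> bool list list" where
  "parity_sets n A b = (let V = (elim_step ^^ n) (map (\<lambda>i. map (\<lambda>j. nthb (wat A i) j) [0..<n] @
       nthb b i # map (\<lambda>q. q = i) [0..<length A]) [0..<length A])
     in if nthb (pivot V) 0
        then map (\<lambda>v. map (\<lambda>q. nthb v (Suc q) \<noteq> (\<not> nthb v 0 \<and> nthb (pivot V) (Suc q))) [0..<length A]) V
        else [])"

lemma ptl_parity_sets: "ptn n k \<Longrightarrow> ptl n A \<Longrightarrow> pt n b \<Longrightarrow> ptl n (\<lambda>xs. parity_sets (k xs) (A xs) (b xs))"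
proof -
  assume kAb: "ptn n k" "ptl n A" "pt n b"
  have "ptl 3 (\<lambda>xs. parity_sets (length (xs ! 0)) (dec (xs ! 1)) (xs ! 2))"
    unfolding parity_sets_def Let_def by (intro ptl_rules pt_pivot ptl_funpow_elim_step; simp)
  from pt_lift3[OF this[unfolded ptl_def] kAb[unfolded ptn_def ptl_def]] show ?thesis by (simp add: ptl_def)
qed

text \<open>Row i of W consists of row i of A, then b at i, then a unit vector. Eliminating the n
  coordinates of A leaves the vectors (h b, h) with h in the left kernel. Completeness has two
  outcomes: without a pivot b is itself a codeword, otherwise the conditions on T give h T = h b on
  the whole kernel, and the Fredholm alternative puts b + T into the image. In both cases some A x
  agrees with b wherever T is 0.\<close>

lemma parity_sets:
  fixes n A b
  defines "m \<equiv> length A"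
  shows parity_sets_sound: "S \<in> set (parity_sets n A b) \<Longrightarrow> length S = m \<and>
      (\<forall>j<n. (\<Sum>i<m. bv S i * bv (A ! i) j) = 0) \<and> (\<Sum>i<m. bv S i * bv b i) = 1"
    and parity_sets_complete: "(\<And>S. S \<in> set (parity_sets n A b) \<Longrightarrow> (\<Sum>i<m. bv S i * T i) = 1) \<Longrightarrow>
      (\<exists>x. \<forall>i<m. (\<Sum>j<n. bv (A ! i) j * x j) = bv b i + T i) \<or>
      (\<exists>x. \<forall>i<m. (\<Sum>j<n. bv (A ! i) j * x j) = bv b i)"
proof -
  define W where "W = map (\<lambda>i. map (\<lambda>j. nthb (wat A i) j) [0..<n] @
       nthb b i # map (\<lambda>q. q = i) [0..<m]) [0..<m]"
  define V where "V = (elim_step ^^ n) W"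
  define p where "p = pivot V"
  have Ss: "parity_sets n A b = (if nthb p 0
        then map (\<lambda>v. map (\<lambda>q. nthb v (Suc q) \<noteq> (\<not> nthb v 0 \<and> nthb p (Suc q))) [0..<m]) V else [])"
    by (simp add: parity_sets_def m_def p_def V_def W_def Let_def)
  have W_len: "length W = m" "\<forall>v\<in>set W. length v = n + Suc m"
    by (auto simp: W_def)
  have W_nth: "bv (W ! i) q = (if q < n then bv (A ! i) q else if q = n then bv b i
      else of_bool (q - Suc n < m \<and> q - Suc n = i))" if "i < m" for i q
  proof -
    have "W ! i = map (\<lambda>j. nthb (wat A i) j) [0..<n] @ nthb b i # map (\<lambda>q. q = i) [0..<m]"
      using that unfolding W_def by simp
    moreover have "q - n = Suc (q - Suc n)" if "\<not> q < n" "q \<noteq> n"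
      using that by simp
    ultimately show ?thesis using that by (auto simp: bv_def nthb_append nthb_Cons m_def split: nat.split)
  qed
  \<comment> \<open>The entries of f after the first are the coefficients h themselves, thanks to
    the identity block; entry 0 is then h b.\<close>
  have LinV: "Lin V f \<longleftrightarrow> (\<forall>j<n. (\<Sum>i<m. f (Suc i) * bv (A ! i) j) = 0) \<and>
      f 0 = (\<Sum>i<m. f (Suc i) * bv b i) \<and> (\<forall>q\<ge>m. f (Suc q) = 0)" (is "_ \<longleftrightarrow> ?R f") for f
  proof -
    have sums: "(\<Sum>i<m. c i * bv (W ! i) q) = (if q < n then \<Sum>i<m. c i * bv (A ! i) q
        else if q = n then \<Sum>i<m. c i * bv b i else if q - Suc n < m then c (q - Suc n) else 0)" for c q
    proof -
      have "(\<Sum>i<m. c i * bv (W ! i) q) = (\<Sum>i<m. c i * of_bool (q - Suc n = i))" if "q > n"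
        using that by (intro sum.cong) (auto simp: W_nth)
      then show ?thesis by (cases "q < n"; cases "q = n") (auto simp: W_nth sum_mult_delta)
    qed
    have "Lin V f \<longleftrightarrow> (\<exists>c. \<forall>q. (if q < n then 0 else f (q - n)) = (\<Sum>i<m. c i * bv (W ! i) q))"
      unfolding V_def Lin_funpow_elim_step[OF W_len(2)] unfolding Lin_def W_len ..
    also have "\<dots> \<longleftrightarrow> ?R f"
    proof
      assume "\<exists>c. \<forall>q. (if q < n then 0 else f (q - n)) = (\<Sum>i<m. c i * bv (W ! i) q)"
      then obtain c where c: "\<And>q. (if q < n then 0 else f (q - n)) = (\<Sum>i<m. c i * bv (W ! i) q)" by blast
      have fc: "f (Suc q) = (if q < m then c q else 0)" for q
        using c[of "n + Suc q"] by (simp add: sums)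
      have fs: "(\<Sum>i<m. f (Suc i) * g i) = (\<Sum>i<m. c i * g i)" for g
        by (intro sum.cong) (auto simp: fc)
      show "?R f" unfolding fs
      proof (intro conjI allI impI)
        show "(\<Sum>i<m. c i * bv (A ! i) j) = 0" if "j < n" for j
          using c[of j] that by (simp add: sums)
        show "f 0 = (\<Sum>i<m. c i * bv b i)" using c[of n] by (simp add: sums)
      qed (simp add: fc)
    next
      assume R: "?R f"
      have "(if q < n then 0 else f (q - n)) = (\<Sum>i<m. f (Suc i) * bv (W ! i) q)" for q
      proof -
        have "q - n = Suc (q - Suc n)" if "q > n" using that by simp
        then show ?thesis using R by (cases "q < n"; cases "q = n") (auto simp: sums)
      qed
      then show "\<exists>c. \<forall>q. (if q < n then 0 else f (q - n)) = (\<Sum>i<m. c i * bv (W ! i) q)"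
        by (intro exI[of _ "\<lambda>i. f (Suc i)"]) blast
    qed
    finally show ?thesis .
  qed
  have pV: "p \<in> set V" if "nthb p 0"
    using that pivot_in_set[of _ V] pivot_Nil[of V] unfolding p_def by (metis nthb_Nil)
  define S where "S v = map (\<lambda>q. nthb v (Suc q) \<noteq> (\<not> nthb v 0 \<and> nthb p (Suc q))) [0..<m]" for v
  have bvS: "bv (S v) i = bv v (Suc i) + (1 + bv v 0) * bv p (Suc i)" if "i < m" for v i
    using that by (auto simp: S_def bv_def of_bool_neq_bit)
  have sumS: "(\<Sum>i<m. bv (S v) i * g i) = (\<Sum>i<m. bv v (Suc i) * g i) + (1 + bv v 0) * (\<Sum>i<m. bv p (Suc i) * g i)"
    for v g
    by (simp add: bvS distrib_right sum.distrib sum_distrib_left mult.assoc)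
  show "length U = m \<and> (\<forall>j<n. (\<Sum>i<m. bv U i * bv (A ! i) j) = 0) \<and> (\<Sum>i<m. bv U i * bv b i) = 1"
    if U: "U \<in> set (parity_sets n A b)" for U
  proof -
    have p: "nthb p 0" using U by (auto simp: Ss split: if_splits)
    then obtain v where v: "v \<in> set V" "U = S v" using U by (auto simp: Ss S_def)
    have L: "Lin V (bv v)" "Lin V (bv p)" using v pV[OF p] Lin_member by auto
    have "bv p 0 = 1" using p by (simp add: bv_def)
    then have "(\<Sum>i<m. bv (S v) i * bv b i) = 1"
      using L unfolding LinV sumS by (metis add.left_commute add.right_neutral bit_add_self mult_1_right)
    then show ?thesis using L unfolding LinV v(2) sumS by (auto simp: S_def)
  qed
  show "(\<exists>x. \<forall>i<m. (\<Sum>j<n. bv (A ! i) j * x j) = bv b i + T i) \<or>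
      (\<exists>x. \<forall>i<m. (\<Sum>j<n. bv (A ! i) j * x j) = bv b i)"
    if T: "\<And>U. U \<in> set (parity_sets n A b) \<Longrightarrow> (\<Sum>i<m. bv U i * T i) = 1"
  proof (cases "nthb p 0")
    case True
    have ST: "(\<Sum>i<m. bv v (Suc i) * T i) + (1 + bv v 0) * (\<Sum>i<m. bv p (Suc i) * T i) = 1"
      if "v \<in> set V" for v
      using T[of "S v"] that True unfolding sumS by (auto simp: Ss S_def)
    have "bv p 0 = 1" using True by (simp add: bv_def)
    \<comment> \<open>The pivot is one of the rows and begins with 1, so its own set is left
      unmodified. Its equation can be subtracted from those of the rows that begin with 0.\<close>
    then have "(\<Sum>i<m. bv p (Suc i) * T i) = 1" using ST[OF pV[OF True]] by simp
    then have vT: "(\<Sum>i<m. bv v (Suc i) * T i) = bv v 0" if "v \<in> set V" for v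
      using ST[OF that] by (cases "bv v 0"; cases "\<Sum>i<m. bv v (Suc i) * T i") simp_all
    have "(\<Sum>i<m. h i * T i) = (\<Sum>i<m. h i * bv b i)"
      if h: "\<forall>j<n. (\<Sum>i<m. h i * bv (A ! i) j) = 0" for h
    proof -
      \<comment> \<open>The vector (h b, h) lies in the row space of V; expanding it reduces the
        claim to single rows, where \<open>vT\<close> applies.\<close>
      define f where "f q = (case q of 0 \<Rightarrow> \<Sum>i<m. h i * bv b i | Suc i \<Rightarrow> if i < m then h i else 0)" for q
      have "Lin V f" unfolding LinV using h by (auto simp: f_def)
      then obtain c where c: "\<And>q. f q = (\<Sum>k<length V. c k * bv (V ! k) q)" unfolding Lin_def by blast
      have "(\<Sum>i<m. h i * T i) = (\<Sum>i<m. (\<Sum>k<length V. c k * bv (V ! k) (Suc i)) * T i)"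
        by (intro sum.cong) (auto simp: f_def simp flip: c)
      also have "\<dots> = (\<Sum>k<length V. c k * (\<Sum>i<m. bv (V ! k) (Suc i) * T i))"
        unfolding sum_distrib_right sum_distrib_left mult.assoc by (rule sum.swap)
      also have "\<dots> = f 0" unfolding c by (intro sum.cong) (auto simp: vT)
      finally show ?thesis by (simp add: f_def)
    qed
    then have "(\<Sum>i<m. h i * (bv b i + T i)) = 0"
      if "\<forall>j<n. (\<Sum>i<m. h i * bv (A ! i) j) = 0" for h
      using that by (simp add: distrib_left sum.distrib)
    then show ?thesis using fredholm_alternative[of m "\<lambda>i. bv (A ! i)" n "\<lambda>i. bv b i + T i"] by fastforce
  next
    case False
    then have nV: "\<not> nthb v 0" if "v \<in> set V" for v
      using that pivot_in_set unfolding p_def by blast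
    have "(\<Sum>i<m. h i * bv b i) = 0" if h: "\<forall>j<n. (\<Sum>i<m. h i * bv (A ! i) j) = 0" for h
    proof -
      define f where "f q = (case q of 0 \<Rightarrow> \<Sum>i<m. h i * bv b i | Suc i \<Rightarrow> if i < m then h i else 0)" for q
      have "Lin V f" unfolding LinV using h by (auto simp: f_def)
      then obtain c where c: "\<And>q. f q = (\<Sum>k<length V. c k * bv (V ! k) q)" unfolding Lin_def by blast
      have "f 0 = 0" unfolding c using nV by (intro sum.neutral) (auto simp: bv_def)
      then show ?thesis by (simp add: f_def)
    qed
    then show ?thesis using fredholm_alternative[of m "\<lambda>i. bv (A ! i)" n "bv b"] by fastforce
  qed
qed

declare enc_seq_simps [simp del]

subsection \<open>Cost-preserving reductions\<close>

lemma cp_reduces_pt: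
  "cp_reduces P Q \<longleftrightarrow> (\<exists>F G. pt 1 F \<and> pt 2 G \<and>
     (\<forall>I. feasible_inst P I \<longrightarrow>
        (\<exists>J. F [enc_i P I] = enc_i Q J \<and> feasible_inst Q J \<and> opt Q J = opt P I \<and>
             (\<forall>S'. sol Q J S' \<longrightarrow>
                (\<exists>S. G [enc_i P I, enc_s Q S'] = enc_s P S \<and> sol P I S \<and>
                     cost P I S \<le> cost Q J S')))))" (is "_ \<longleftrightarrow> (\<exists>F G. pt 1 F \<and> pt 2 G \<and> ?R F G)")
proof
  assume "\<exists>F G. pt 1 F \<and> pt 2 G \<and> ?R F G"
  then obtain F G where FG: "pt 1 F" "pt 2 G" "?R F G" by blast
  obtain f where f: "cobham 1 f" "\<And>x. f [x] = F [x]"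
    using FG(1) by (auto simp: pt_def)
  obtain g where g: "cobham 2 g" "\<And>x y. g [x, y] = G [x, y]"
    using FG(2) by (auto simp: pt_def)
  show "cp_reduces P Q"
    unfolding cp_reduces_def using f(1) g(1) FG(3)
    by (intro exI[of _ f] exI[of _ g]) (simp add: f(2) g(2))
next
  assume "cp_reduces P Q"
  moreover have "cobham n f \<Longrightarrow> pt n f" for n f by (auto simp: pt_def)
  ultimately show "\<exists>F G. pt 1 F \<and> pt 2 G \<and> ?R F G"
    unfolding cp_reduces_def by blast
qed

lemma cp_reduces_trans [trans]:
  assumes "cp_reduces P Q" "cp_reduces Q R"
  shows "cp_reduces P R"
proof -
  obtain F1 G1 where 1: "pt 1 F1" "pt 2 G1" and I1: "\<And>I. feasible_inst P I \<Longrightarrow>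
        \<exists>J. F1 [enc_i P I] = enc_i Q J \<and> feasible_inst Q J \<and> opt Q J = opt P I \<and>
             (\<forall>S'. sol Q J S' \<longrightarrow> (\<exists>S. G1 [enc_i P I, enc_s Q S'] = enc_s P S \<and> sol P I S \<and>
                     cost P I S \<le> cost Q J S'))"
    using assms(1) unfolding cp_reduces_pt by blast
  obtain F2 G2 where 2: "pt 1 F2" "pt 2 G2" and I2: "\<And>I. feasible_inst Q I \<Longrightarrow>
        \<exists>J. F2 [enc_i Q I] = enc_i R J \<and> feasible_inst R J \<and> opt R J = opt Q I \<and>
             (\<forall>S'. sol R J S' \<longrightarrow> (\<exists>S. G2 [enc_i Q I, enc_s R S'] = enc_s Q S \<and> sol Q I S \<and>
                     cost Q I S \<le> cost R J S'))"
    using assms(2) unfolding cp_reduces_pt by blast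
  have p: "pt 1 (\<lambda>xs. xs ! 0)" "pt 2 (\<lambda>xs. xs ! 0)" "pt 2 (\<lambda>xs. xs ! 1)"
    by (auto intro: pt_proj)
  show ?thesis
    unfolding cp_reduces_pt
  proof (rule exI, rule exI, rule conjI, rule_tac [2] conjI, rule_tac [3] allI, rule_tac [3] impI)
    show "pt 1 (\<lambda>xs. F2 [F1 [xs ! 0]])"
      using pt_lift1[OF 2(1) pt_lift1[OF 1(1) p(1)]] .
    \<comment> \<open>The inner solution map needs the intermediate instance, which is recomputed
      from the original one.\<close>
    show "pt 2 (\<lambda>xs. G1 [xs ! 0, G2 [F1 [xs ! 0], xs ! 1]])"
      using pt_lift2[OF 1(2) p(2) pt_lift2[OF 2(2) pt_lift1[OF 1(1) p(2)] p(3)]] .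
    fix I assume "feasible_inst P I"
    from I1[OF this] obtain J where J: "F1 [enc_i P I] = enc_i Q J" "feasible_inst Q J" "opt Q J = opt P I"
      "\<And>S'. sol Q J S' \<Longrightarrow> \<exists>S. G1 [enc_i P I, enc_s Q S'] = enc_s P S \<and> sol P I S \<and> cost P I S \<le> cost Q J S'"
      by blast
    from I2[OF J(2)] obtain K where K: "F2 [enc_i Q J] = enc_i R K" "feasible_inst R K" "opt R K = opt Q J"
      "\<And>S'. sol R K S' \<Longrightarrow> \<exists>S. G2 [enc_i Q J, enc_s R S'] = enc_s Q S \<and> sol Q J S \<and> cost Q J S \<le> cost R K S'"
      by blast
    have sols: "\<exists>S. G1 [enc_i P I, G2 [enc_i Q J, enc_s R S']] = enc_s P S \<and> sol P I S \<and> cost P I S \<le> cost R K S'"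
      if S': "sol R K S'" for S'
    proof -
      obtain T where T: "G2 [enc_i Q J, enc_s R S'] = enc_s Q T" "sol Q J T" "cost Q J T \<le> cost R K S'"
        using K(4)[OF S'] by blast
      obtain S where "G1 [enc_i P I, enc_s Q T] = enc_s P S" "sol P I S" "cost P I S \<le> cost Q J T"
        using J(4)[OF T(2)] by blast
      then show ?thesis using T by (intro exI[of _ S]) simp
    qed
    have "F2 [F1 [enc_i P I]] = enc_i R K" "opt R K = opt P I"
      using J(1,3) K(1,3) by simp_all
    then show "\<exists>J. F2 [F1 [[enc_i P I] ! 0]] = enc_i R J \<and> feasible_inst R J \<and> opt R J = opt P I \<and>
             (\<forall>S'. sol R J S' \<longrightarrow> (\<exists>S. G1 [[enc_i P I, enc_s R S'] ! 0, G2 [F1 [[enc_i P I, enc_s R S'] ! 0],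
                 [enc_i P I, enc_s R S'] ! 1]] = enc_s P S \<and> sol P I S \<and> cost P I S \<le> cost R J S'))"
      unfolding One_nat_def nth_Cons_Suc nth_Cons_0 J(1)
      using K(2) sols by blast
  qed
qed

text \<open>Translations of solutions in both directions that never increase the cost force equal
  optima, and the forward one also makes J feasible. Only the backward one has to be
  computable.\<close>

lemma cp_reducesI:
  assumes F: "pt 1 F" and G: "pt 2 G"
    and red: "\<And>I. feasible_inst P I \<Longrightarrow> \<exists>J. F [enc_i P I] = enc_i Q J \<and> inst Q J \<and>
      (\<forall>S. sol P I S \<longrightarrow> (\<exists>S'. sol Q J S' \<and> cost Q J S' \<le> cost P I S)) \<and>
      (\<forall>S'. sol Q J S' \<longrightarrow> (\<exists>S. G [enc_i P I, enc_s Q S'] = enc_s P S \<and> sol P I S \<and> cost P I S \<le> cost Q J S'))"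
  shows "cp_reduces P Q"
  unfolding cp_reduces_pt
proof (rule exI[of _ F], rule exI[of _ G], rule conjI[OF F], rule conjI[OF G], rule allI, rule impI)
  fix I assume I: "feasible_inst P I"
  from red[OF I] obtain J where J: "F [enc_i P I] = enc_i Q J" "inst Q J"
      "\<And>S. sol P I S \<Longrightarrow> \<exists>S'. sol Q J S' \<and> cost Q J S' \<le> cost P I S"
      "\<And>S'. sol Q J S' \<Longrightarrow> \<exists>S. G [enc_i P I, enc_s Q S'] = enc_s P S \<and> sol P I S \<and> cost P I S \<le> cost Q J S'"
    by blast
  obtain S0 where S0: "sol P I S0" using I unfolding feasible_inst_def by blast
  obtain T0 where T0: "sol Q J T0" using J(3)[OF S0] by blast
  have "opt Q J \<le> opt P I"
  proof -
    have "\<exists>S. sol P I S \<and> cost P I S = opt P I"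
      unfolding opt_def by (rule LeastI_ex) (use S0 in blast)
    then obtain S S' where "cost P I S = opt P I" "sol Q J S'" "cost Q J S' \<le> cost P I S"
      using J(3) by blast
    moreover have "opt Q J \<le> cost Q J S'"
      unfolding opt_def by (rule Least_le) (use \<open>sol Q J S'\<close> in blast)
    ultimately show ?thesis by simp
  qed
  moreover have "opt P I \<le> opt Q J"
  proof -
    have "\<exists>S. sol Q J S \<and> cost Q J S = opt Q J"
      unfolding opt_def by (rule LeastI_ex) (use T0 in blast)
    then obtain S S' where "cost Q J S' = opt Q J" "sol P I S" "cost P I S \<le> cost Q J S'"
      using J(4) by blast
    moreover have "opt P I \<le> cost P I S"
      unfolding opt_def by (rule Least_le) (use \<open>sol P I S\<close> in blast)
    ultimately show ?thesis by simp
  qed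
  ultimately show "\<exists>J. F [enc_i P I] = enc_i Q J \<and> feasible_inst Q J \<and> opt Q J = opt P I \<and>
      (\<forall>S'. sol Q J S' \<longrightarrow> (\<exists>S. G [enc_i P I, enc_s Q S'] = enc_s P S \<and> sol P I S \<and> cost P I S \<le> cost Q J S'))"
    using J T0 by (intro exI[of _ J]) (auto simp: feasible_inst_def)
qed

text \<open>The inner product in the counting form covered by the closure rules.\<close>

definition dotw :: "bool list \<Rightarrow> bool list \<Rightarrow> bool" where
  "dotw r x = odd (length (filter (\<lambda>j. nthb r j \<and> nthb x j) [0..<length r]))"

lemma ptb_dotw: "pt n f \<Longrightarrow> pt n g \<Longrightarrow> ptb n (\<lambda>xs. dotw (f xs) (g xs))"
proof -
  assume fg: "pt n f" "pt n g"
  have "ptb 2 (\<lambda>xs. dotw (xs ! 0) (xs ! 1))"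
    unfolding dotw_def by (intro pt_rules; simp)
  from pt_lift2[OF this[unfolded ptb_def] fg] show ?thesis by (simp add: ptb_def)
qed

lemma of_bool_odd_length_filter: "of_bool (odd (length (filter P [0..<n]))) = (\<Sum>j<n. of_bool (P j) :: bit)"
  by (simp add: length_filter_conv_card of_bool_odd_card cong: conj_cong)

lemma of_bool_dotw: "of_bool (dotw r x) = (\<Sum>j<length r. bv r j * bv x j)"
  by (simp add: dotw_def of_bool_odd_length_filter bv_def of_bool_conj)

lemma odd_card_dotw:
  "length r = n \<Longrightarrow> length x = n \<Longrightarrow> odd (card {j. j < n \<and> r ! j \<and> x ! j}) = dotw r x"
  by (simp add: dotw_def length_filter_conv_card nthb_def cong: conj_cong)

lemma gf2_dot_dotw: "length r = length x \<Longrightarrow> gf2_dot r x = dotw r x"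
  unfolding gf2_dot_def by (rule odd_card_dotw) auto

subsection \<open>MinCSP to Nearest Codeword\<close>

text \<open>A variable may occur several times in one constraint, and equal occurrences cancel mod
  2; hence the parity of their number. Entry 0 of c is the relation index, so arguments start at
  \<open>Suc k\<close>.\<close>

definition csp_row :: "nat \<Rightarrow> bool list list \<Rightarrow> bool list" where
  "csp_row n c = map (\<lambda>j. odd (length (filter (\<lambda>k. wat c (Suc k) = bin j) [0..<length c - 1]))) [0..<n]"

text \<open>\<open>[True]\<close> is \<open>bin 1\<close>, the index of the disequality in
  \<open>B3\<close>, which is its only relation with right-hand side 1.\<close>

definition csp_rhs :: "bool list list \<Rightarrow> bool" where
  "csp_rhs c \<longleftrightarrow> wat c 0 = [True]"

lemma bin_1 [simp]: "bin (Suc 0) = [True]"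
  by (subst bin.simps) simp

lemma bin_2 [simp]: "bin 2 = [False, True]"
  by (subst bin.simps) simp

lemma csp_rhs_code: "csp_rhs (bin r # ws) \<longleftrightarrow> r = 1"
  using bin_inject[of r 1] by (simp add: csp_rhs_def wat_def)

lemma length_csp_row [simp]: "length (csp_row n c) = n"
  by (simp add: csp_row_def)

lemma of_bool_odd_length_filter_id:
  "of_bool (odd (length (filter id (map f s)))) = (\<Sum>k<length s. of_bool (f (s ! k)) :: bit)"
  by (simp add: length_filter_conv_card of_bool_odd_card cong: conj_cong)

text \<open>Exchanging the sums over variables and over argument positions turns occurrence counts
  into the sum of the argument values.\<close>

lemma dotw_csp_row:
  assumes "\<forall>v\<in>set s. v < n"
  shows "dotw (csp_row n (w # map bin s)) x = odd (length (filter id (map (nthb x) s)))"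
proof -
  let ?m = "length s"
  have row: "bv (csp_row n (w # map bin s)) j = (\<Sum>k<?m. of_bool (s ! k = j))" if "j < n" for j
  proof -
    have "filter (\<lambda>k. wat (w # map bin s) (Suc k) = bin j) [0..<?m] = filter (\<lambda>k. s ! k = j) [0..<?m]"
      by (rule filter_cong) (auto simp: wat_def bin_inject)
    then show ?thesis using that by (simp add: bv_def csp_row_def of_bool_odd_length_filter)
  qed
  have "of_bool (dotw (csp_row n (w # map bin s)) x) = (\<Sum>j<n. (\<Sum>k<?m. of_bool (s ! k = j)) * bv x j)"
    by (simp add: of_bool_dotw row)
  also have "\<dots> = (\<Sum>k<?m. \<Sum>j<n. bv x j * of_bool (s ! k = j))"
    unfolding sum_distrib_right by (subst sum.swap) (simp add: mult.commute[of "of_bool _"])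
  also have "\<dots> = (\<Sum>k<?m. of_bool (nthb x (s ! k)))"
    using assms by (intro sum.cong) (auto simp: sum_mult_delta bv_def)
  also have "\<dots> = of_bool (odd (length (filter id (map (nthb x) s))))"
    by (rule of_bool_odd_length_filter_id[symmetric])
  finally show ?thesis by (simp only: of_bool_eq_iff)
qed

text \<open>Under an assignment, the violated constraints are exactly the positions where A x and b
  differ. The least deletion set for x is therefore its error vector, which needs no search.\<close>

lemma mincsp_reduces_nearest_codeword:
  assumes \<Gamma>: "\<And>r t. r < length \<Gamma> \<Longrightarrow> length t = fst (\<Gamma> ! r) \<Longrightarrow>
    t \<in> snd (\<Gamma> ! r) \<longleftrightarrow> (odd (length (filter id t)) \<longleftrightarrow> r = 1)"
  shows "cp_reduces (mincsp \<Gamma>) nearest_codeword"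
proof (rule cp_reducesI)
  let ?n = "\<lambda>xs. length (wat (dec (xs ! 0)) 0)"
  let ?cs = "\<lambda>xs. dec (wat (dec (xs ! 0)) 1)"
  let ?F = "\<lambda>xs. enc_seq [wat (dec (xs ! 0)) 0, enc_seq (map (\<lambda>c. csp_row (?n xs) (dec c)) (?cs xs)),
      map (\<lambda>i. csp_rhs (dec (wat (?cs xs) i))) [0..<length (?cs xs)]]"
  let ?G = "\<lambda>xs. map (\<lambda>i. dotw (csp_row (?n xs) (dec (wat (?cs xs) i))) (xs ! 1) \<noteq> csp_rhs (dec (wat (?cs xs) i)))
      [0..<length (?cs xs)]"
  show "pt 1 ?F" unfolding csp_row_def csp_rhs_def by (intro ptl_rules; simp)
  show "pt 2 ?G" unfolding csp_row_def csp_rhs_def by (intro ptl_rules ptb_dotw; simp)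
  fix I assume "feasible_inst (mincsp \<Gamma>) I"
  moreover obtain n cs where I: "I = (n, cs)" by force
  ultimately have cs: "\<And>r s. (r, s) \<in> set cs \<Longrightarrow> r < length \<Gamma> \<and> length s = fst (\<Gamma> ! r) \<and> (\<forall>v\<in>set s. v < n)"
    by (auto simp: feasible_inst_def mincsp_def)
  define row where "row i = csp_row n (bin (fst (cs ! i)) # map bin (snd (cs ! i)))" for i
  define A where "A = map row [0..<length cs]"
  define b where "b = map (\<lambda>i. fst (cs ! i) = 1) [0..<length cs]"
  have enc: "dec (enc_i (mincsp \<Gamma>) I) = [unary n, enc_seq (map (\<lambda>(r, s). enc_seq (bin r # map bin s)) cs)]"
    by (simp add: mincsp_def I)
  have codes: "dec (wat (map (\<lambda>(r, s). enc_seq (bin r # map bin s)) cs) i) = bin (fst (cs ! i)) # map bin (snd (cs ! i))"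
    if "i < length cs" for i
    using that by (simp add: case_prod_unfold)
  have sat: "map \<alpha> (snd (cs ! i)) \<in> snd (\<Gamma> ! fst (cs ! i)) \<longleftrightarrow> gf2_dot (A ! i) x = b ! i"
    if i: "i < length cs" and x: "length x = n" and \<alpha>: "\<And>v. v < n \<Longrightarrow> \<alpha> v = nthb x v" for i x \<alpha>
  proof -
    obtain r s where rs: "cs ! i = (r, s)" by force
    then have "(r, s) \<in> set cs" using i by (metis nth_mem)
    note rs_ok = cs[OF this]
    then have sx: "map \<alpha> s = map (nthb x) s" using \<alpha> by auto
    have dot: "gf2_dot (A ! i) x = odd (length (filter id (map (nthb x) s)))"
      using i x rs rs_ok by (simp add: A_def row_def gf2_dot_dotw dotw_csp_row)
    show ?thesis
      unfolding rs fst_conv snd_conv sx dot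
      using \<Gamma>[of r "map (nthb x) s"] rs_ok i rs by (simp add: b_def)
  qed
  show "\<exists>J. ?F [enc_i (mincsp \<Gamma>) I] = enc_i nearest_codeword J \<and> inst nearest_codeword J \<and>
      (\<forall>S. sol (mincsp \<Gamma>) I S \<longrightarrow> (\<exists>S'. sol nearest_codeword J S' \<and> cost nearest_codeword J S' \<le> cost (mincsp \<Gamma>) I S)) \<and>
      (\<forall>S'. sol nearest_codeword J S' \<longrightarrow> (\<exists>S. ?G [enc_i (mincsp \<Gamma>) I, enc_s nearest_codeword S'] = enc_s (mincsp \<Gamma>) S \<and>
        sol (mincsp \<Gamma>) I S \<and> cost (mincsp \<Gamma>) I S \<le> cost nearest_codeword J S'))"
  proof (intro exI[of _ "(n, A, b)"] conjI allI impI)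
    have "map (\<lambda>c. csp_row n (dec c)) (map (\<lambda>(r, s). enc_seq (bin r # map bin s)) cs) = A"
      by (rule nth_equalityI) (simp_all add: A_def row_def case_prod_unfold)
    moreover have "map (\<lambda>i. csp_rhs (dec (wat (map (\<lambda>(r, s). enc_seq (bin r # map bin s)) cs) i))) [0..<length cs] = b"
      by (simp add: b_def case_prod_unfold csp_rhs_code)
    ultimately show "?F [enc_i (mincsp \<Gamma>) I] = enc_i nearest_codeword (n, A, b)"
      by (simp add: enc nearest_codeword_def)
    show "inst nearest_codeword (n, A, b)"
      by (auto simp: nearest_codeword_def A_def b_def row_def)
  next
    fix W assume "sol (mincsp \<Gamma>) I W"
    then obtain \<alpha> where W: "length W = length cs"
      and \<alpha>: "\<And>i. i < length cs \<Longrightarrow> \<not> W ! i \<Longrightarrow> map \<alpha> (snd (cs ! i)) \<in> snd (\<Gamma> ! fst (cs ! i))"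
      by (auto simp: mincsp_def I)
    let ?x = "map \<alpha> [0..<n]"
    have "{i. i < length cs \<and> gf2_dot (A ! i) ?x \<noteq> b ! i} \<subseteq> {i. i < length W \<and> W ! i}"
      using W sat[of _ ?x \<alpha>] \<alpha> by auto
    then have "card {i. i < length cs \<and> gf2_dot (A ! i) ?x \<noteq> b ! i} \<le> card {i. i < length W \<and> W ! i}"
      by (intro card_mono) auto
    then show "\<exists>S'. sol nearest_codeword (n, A, b) S' \<and> cost nearest_codeword (n, A, b) S' \<le> cost (mincsp \<Gamma>) I W"
      by (intro exI[of _ ?x]) (simp add: nearest_codeword_def mincsp_def I A_def)
  next
    fix x assume "sol nearest_codeword (n, A, b) x"
    then have x: "length x = n" by (simp add: nearest_codeword_def)
    let ?W = "map (\<lambda>i. gf2_dot (A ! i) x \<noteq> b ! i) [0..<length cs]"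
    have "?G [enc_i (mincsp \<Gamma>) I, x] = ?W"
      using x by (simp add: enc case_prod_unfold A_def b_def row_def gf2_dot_dotw csp_rhs_code)
    moreover have "sol (mincsp \<Gamma>) I ?W"
      using sat[OF _ x, of _ "nthb x"] by (auto simp: mincsp_def I)
    moreover have "{i. i < length ?W \<and> ?W ! i} = {i. i < length A \<and> gf2_dot (A ! i) x \<noteq> b ! i}"
      by (auto simp: A_def)
    then have "cost (mincsp \<Gamma>) I ?W = cost nearest_codeword (n, A, b) x"
      by (simp add: mincsp_def nearest_codeword_def I)
    ultimately show "\<exists>S. ?G [enc_i (mincsp \<Gamma>) I, enc_s nearest_codeword x] = enc_s (mincsp \<Gamma>) S \<and>
        sol (mincsp \<Gamma>) I S \<and> cost (mincsp \<Gamma>) I S \<le> cost nearest_codeword (n, A, b) x"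
      by (intro exI[of _ ?W]) (simp add: mincsp_def nearest_codeword_def)
  qed
qed

lemma B3_reduces_nearest_codeword: "cp_reduces (mincsp B3) nearest_codeword"
proof (rule mincsp_reduces_nearest_codeword)
  fix r :: nat and t :: "bool list" assume "r < length B3" "length t = fst (B3 ! r)"
  then consider "r = 0" "length t = 4" | "r = 1" "length t = 2"
    by (auto simp: B3_def less_Suc_eq)
  then show "t \<in> snd (B3 ! r) \<longleftrightarrow> (odd (length (filter id t)) \<longleftrightarrow> r = 1)"
    by cases (auto simp: B3_def EVEN4_def numeral_2_eq_2 length_Suc_conv split: if_splits)
qed

subsection \<open>B2 to B3\<close>

text \<open>Both relations of B3 are invariant under complementing all variables, so the extra
  variable n can be taken to be 0.\<close>

definition relativise :: "nat \<Rightarrow> nat \<times> nat list \<Rightarrow> nat \<times> nat list" where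
  "relativise n c = (if fst c = 0 then c else if fst c = 1 then (1, snd c @ [n]) else (0, snd c @ [n, n, n]))"

text \<open>In EVEN4 the shift by \<open>\<beta> n\<close> occurs four times and cancels. Value 1
  relative to n is disequality with n, and EVEN4 with three copies of n says that the remaining
  variable agrees with n.\<close>

lemma relativise_sat:
  assumes "r < length B2" "length s = fst (B2 ! r)" "\<forall>v\<in>set s. \<alpha> v = (\<beta> v \<noteq> \<beta> n)"
  shows "map \<alpha> s \<in> snd (B2 ! r) \<longleftrightarrow>
    map \<beta> (snd (relativise n (r, s))) \<in> snd (B3 ! fst (relativise n (r, s)))"
proof -
  consider "r = 0" "length s = 4" | "r = 1" "length s = 1" | "r = 2" "length s = 1"
    using assms(1,2) by (auto simp: B2_def less_Suc_eq numeral_2_eq_2)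
  then show ?thesis
  proof cases
    case 1
    then obtain a b c d where "s = [a, b, c, d]" by (auto simp: length_Suc_conv numeral_eq_Suc)
    then show ?thesis using 1 assms(3)
      by (cases "\<beta> n") (simp_all add: B2_def B3_def EVEN4_def relativise_def)
  next
    case 2
    then obtain a where "s = [a]" by (auto simp: length_Suc_conv)
    then show ?thesis using 2 assms(3) by (auto simp: B2_def B3_def relativise_def)
  next
    case 3
    then obtain a where "s = [a]" by (auto simp: length_Suc_conv)
    then show ?thesis using 3 assms(3)
      by (cases "\<beta> n") (simp_all add: B2_def B3_def EVEN4_def relativise_def)
  qed
qed

lemma relativise_valid:
  assumes "r < length B2" "length s = fst (B2 ! r)" "\<forall>v\<in>set s. v < n"
  shows "case relativise n (r, s) of (r', s') \<Rightarrow>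
    r' < length B3 \<and> length s' = fst (B3 ! r') \<and> (\<forall>v\<in>set s'. v < Suc n)"
  using assms by (auto simp: B2_def B3_def relativise_def less_Suc_eq numeral_2_eq_2)

text \<open>Constraint lists must stay duplicate-free. Changed constraints contain n while original
  ones do not, and the new relation index tells the two unary relations apart.\<close>

lemma relativise_inject:
  assumes "\<forall>v\<in>set (snd c). v < n" "\<forall>v\<in>set (snd d). v < n" "fst c < length B2" "fst d < length B2"
    and "relativise n c = relativise n d"
  shows "c = d"
proof -
  have "n \<notin> set (snd c)" "n \<notin> set (snd d)" using assms by auto
  moreover have "n \<in> set (snd (relativise n e)) \<or> fst e = 0" for e
    by (auto simp: relativise_def)
  ultimately show ?thesis using assms(3-5)
    by (cases c; cases d) (auto simp: relativise_def B2_def less_Suc_eq split: if_splits)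
qed

lemma B2_reduces_B3: "cp_reduces (mincsp B2) (mincsp B3)"
proof (rule cp_reducesI)
  let ?n = "\<lambda>xs. length (wat (dec (xs ! 0)) 0)"
  let ?cs = "\<lambda>xs. dec (wat (dec (xs ! 0)) 1)"
  let ?conv = "\<lambda>n c. if wat (dec c) 0 = [] then c else if wat (dec c) 0 = [True]
      then enc_seq (dec c @ [bin n]) else enc_seq [[], wat (dec c) 1, bin n, bin n, bin n]"
  \<comment> \<open>The leading \<open>True\<close> lengthens the unary count by the additional
    variable.\<close>
  let ?F = "\<lambda>xs. enc_seq [True # wat (dec (xs ! 0)) 0, enc_seq (map (\<lambda>c. ?conv (?n xs) c) (?cs xs))]"
  show "pt 1 ?F" by (intro ptl_rules; simp)
  \<comment> \<open>Constraints keep their positions, so the deletion vector is passed back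
    unchanged.\<close>
  show "pt 2 (\<lambda>xs. xs ! 1)" by (intro pt_rules) simp
  fix I assume "feasible_inst (mincsp B2) I"
  moreover obtain n cs where I: "I = (n, cs)" by force
  ultimately have dist: "distinct cs"
    and cs: "\<And>c. c \<in> set cs \<Longrightarrow> fst c < length B2 \<and> length (snd c) = fst (B2 ! fst c) \<and> (\<forall>v\<in>set (snd c). v < n)"
    by (auto simp: feasible_inst_def mincsp_def)
  let ?J = "(Suc n, map (relativise n) cs)"
  have enc: "dec (enc_i (mincsp B2) I) = [unary n, enc_seq (map (\<lambda>(r, s). enc_seq (bin r # map bin s)) cs)]"
    by (simp add: mincsp_def I)
  have conv: "?conv n (enc_seq (bin r # map bin s)) = (case relativise n (r, s) of (r, s) \<Rightarrow> enc_seq (bin r # map bin s))"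
    if mem: "(r, s) \<in> set cs" for r s
  proof -
    consider "r = 0" | "r = 1" | "r = 2" "length s = 1"
      using cs[OF mem] by (auto simp: B2_def less_Suc_eq numeral_2_eq_2)
    then show ?thesis
      by cases (auto simp: relativise_def wat_def length_Suc_conv)
  qed
  show "\<exists>J. ?F [enc_i (mincsp B2) I] = enc_i (mincsp B3) J \<and> inst (mincsp B3) J \<and>
      (\<forall>S. sol (mincsp B2) I S \<longrightarrow> (\<exists>S'. sol (mincsp B3) J S' \<and> cost (mincsp B3) J S' \<le> cost (mincsp B2) I S)) \<and>
      (\<forall>S'. sol (mincsp B3) J S' \<longrightarrow> (\<exists>S. [enc_i (mincsp B2) I, enc_s (mincsp B3) S'] ! 1 = enc_s (mincsp B2) S \<and>
        sol (mincsp B2) I S \<and> cost (mincsp B2) I S \<le> cost (mincsp B3) J S'))"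
  proof (intro exI[of _ ?J] conjI allI impI)
    have w: "wat (dec ([enc_i (mincsp B2) I] ! 0)) 0 = unary n"
        "dec (wat (dec ([enc_i (mincsp B2) I] ! 0)) 1) = map (\<lambda>(r, s). enc_seq (bin r # map bin s)) cs"
      by (simp_all add: enc)
    have convs: "map (\<lambda>c. ?conv n c) (map (\<lambda>(r, s). enc_seq (bin r # map bin s)) cs)
        = map (\<lambda>(r, s). enc_seq (bin r # map bin s)) (map (relativise n) cs)"
      unfolding map_map
    proof (rule map_cong[OF refl])
      fix c assume "c \<in> set cs"
      moreover obtain r s where "c = (r, s)" by force
      ultimately show "((\<lambda>c. ?conv n c) \<circ> (\<lambda>(r, s). enc_seq (bin r # map bin s))) c
          = ((\<lambda>(r, s). enc_seq (bin r # map bin s)) \<circ> relativise n) c"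
        using conv[of r s] by (simp only: o_apply prod.case)
    qed
    show "?F [enc_i (mincsp B2) I] = enc_i (mincsp B3) ?J"
      unfolding w length_unary convs by (simp add: mincsp_def unary_def)
    have "inj_on (relativise n) (set cs)"
      by (rule inj_onI, erule relativise_inject[rotated 4]) (use cs in auto)
    moreover have "\<forall>c\<in>set cs. case relativise n c of (r', s') \<Rightarrow>
        r' < length B3 \<and> length s' = fst (B3 ! r') \<and> (\<forall>v\<in>set s'. v < Suc n)"
    proof
      fix c assume "c \<in> set cs"
      from cs[OF this] show "case relativise n c of (r', s') \<Rightarrow>
          r' < length B3 \<and> length s' = fst (B3 ! r') \<and> (\<forall>v\<in>set s'. v < Suc n)"
        using relativise_valid[of "fst c" "snd c" n] by simp
    qed
    ultimately show "inst (mincsp B3) ?J"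
      using dist by (simp add: mincsp_def distinct_map)
  next
    fix W assume "sol (mincsp B2) I W"
    then obtain \<alpha> where W: "length W = length cs"
      and \<alpha>: "\<And>i. i < length cs \<Longrightarrow> \<not> W ! i \<Longrightarrow> map \<alpha> (snd (cs ! i)) \<in> snd (B2 ! fst (cs ! i))"
      by (auto simp: mincsp_def I)
    have "map (\<alpha>(n := False)) (snd (relativise n (cs ! i))) \<in> snd (B3 ! fst (relativise n (cs ! i)))"
      if "i < length cs" "\<not> W ! i" for i
      using relativise_sat[of "fst (cs ! i)" "snd (cs ! i)" \<alpha> "\<alpha>(n := False)" n] \<alpha>[OF that] cs[OF nth_mem[OF that(1)]]
      by auto
    then show "\<exists>S'. sol (mincsp B3) ?J S' \<and> cost (mincsp B3) ?J S' \<le> cost (mincsp B2) I W"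
      using W by (intro exI[of _ W]) (auto simp: mincsp_def I)
  next
    fix W assume "sol (mincsp B3) ?J W"
    then obtain \<beta> where W: "length W = length cs"
      and \<beta>: "\<And>i. i < length cs \<Longrightarrow> \<not> W ! i \<Longrightarrow>
        map \<beta> (snd (relativise n (cs ! i))) \<in> snd (B3 ! fst (relativise n (cs ! i)))"
      by (auto simp: mincsp_def)
    have "map (\<lambda>v. \<beta> v \<noteq> \<beta> n) (snd (cs ! i)) \<in> snd (B2 ! fst (cs ! i))"
      if "i < length cs" "\<not> W ! i" for i
      using relativise_sat[of "fst (cs ! i)" "snd (cs ! i)" "\<lambda>v. \<beta> v \<noteq> \<beta> n" \<beta> n] \<beta>[OF that] cs[OF nth_mem[OF that(1)]]
      by auto
    then have "sol (mincsp B2) I W"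
      using W by (auto simp: mincsp_def I)
    then show "\<exists>S. [enc_i (mincsp B2) I, enc_s (mincsp B3) W] ! 1 = enc_s (mincsp B2) S \<and>
        sol (mincsp B2) I S \<and> cost (mincsp B2) I S \<le> cost (mincsp B3) ?J W"
      by (intro exI[of _ W]) (simp add: mincsp_def I)
  qed
qed

subsection \<open>Nearest Codeword to Odd Set\<close>

lemma bv_nth: "i < length w \<Longrightarrow> bv w i = of_bool (w ! i)"
  by (simp add: bv_def nthb_def)

lemma nearest_codeword_reduces_odd_set: "cp_reduces nearest_codeword odd_set"
proof (rule cp_reducesI)
  let ?n = "\<lambda>xs. length (wat (dec (xs ! 0)) 0)"
  let ?A = "\<lambda>xs. dec (wat (dec (xs ! 0)) 1)"
  let ?b = "\<lambda>xs. wat (dec (xs ! 0)) 2"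
  let ?F = "\<lambda>xs. enc_seq [unary (length (?A xs)), enc_seq (parity_sets (?n xs) (?A xs) (?b xs))]"
  \<comment> \<open>Positions in T get a zero row with right-hand side 0, so their equations become
    trivial while all indices are kept.\<close>
  let ?G = "\<lambda>xs. solve (?n xs)
      (map (\<lambda>i. if nthb (xs ! 1) i then [] else wat (?A xs) i) [0..<length (?A xs)])
      (map (\<lambda>i. nthb (?b xs) i \<and> \<not> nthb (xs ! 1) i) [0..<length (?A xs)])"
  show "pt 1 ?F" by (intro ptl_rules ptl_parity_sets; simp)
  show "pt 2 ?G" by (intro ptl_rules pt_solve; simp)
  fix I assume "feasible_inst nearest_codeword I"
  moreover obtain n A b where I: "I = (n, A, b)" by (metis prod_cases3)
  ultimately have b: "length b = length A" and rows: "\<And>i. i < length A \<Longrightarrow> length (A ! i) = n"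
    by (auto simp: feasible_inst_def nearest_codeword_def)
  define m where "m = length A"
  let ?J = "(m, parity_sets n A b)"
  have enc: "dec (enc_i nearest_codeword I) = [unary n, enc_seq A, b]"
    by (simp add: nearest_codeword_def I)
  have dot: "of_bool (gf2_dot (A ! i) x) = (\<Sum>j<n. bv (A ! i) j * bv x j)" if "i < m" "length x = n" for i x
    using that rows by (simp add: m_def gf2_dot_dotw of_bool_dotw)
  show "\<exists>J. ?F [enc_i nearest_codeword I] = enc_i odd_set J \<and> inst odd_set J \<and>
      (\<forall>S. sol nearest_codeword I S \<longrightarrow> (\<exists>S'. sol odd_set J S' \<and> cost odd_set J S' \<le> cost nearest_codeword I S)) \<and>
      (\<forall>S'. sol odd_set J S' \<longrightarrow> (\<exists>S. ?G [enc_i nearest_codeword I, enc_s odd_set S'] = enc_s nearest_codeword S \<and>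
        sol nearest_codeword I S \<and> cost nearest_codeword I S \<le> cost odd_set J S'))"
  proof (intro exI[of _ ?J] conjI allI impI)
    show "?F [enc_i nearest_codeword I] = enc_i odd_set ?J"
      by (simp add: enc odd_set_def m_def wat_def)
    show "inst odd_set ?J"
      using parity_sets_sound[of _ n A b] by (auto simp: odd_set_def m_def)
  next
    fix x assume "sol nearest_codeword I x"
    then have x: "length x = n" by (simp add: nearest_codeword_def I)
    define T where "T = map (\<lambda>i. gf2_dot (A ! i) x \<noteq> b ! i) [0..<m]"
    have "odd (card {i. i < m \<and> S ! i \<and> T ! i})" if "S \<in> set (parity_sets n A b)" for S
    proof -
      have S: "length S = m" "\<And>j. j < n \<Longrightarrow> (\<Sum>i<m. bv S i * bv (A ! i) j) = 0" "(\<Sum>i<m. bv S i * bv b i) = 1"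
        using parity_sets_sound[OF that] by (auto simp: m_def T_def)
      have bvT: "bv T i = bv b i + (\<Sum>j<n. bv (A ! i) j * bv x j)" if "i < m" for i
      proof -
        have "bv T i = of_bool (gf2_dot (A ! i) x) + of_bool (b ! i)"
          using that by (simp only: T_def bv_nth length_map length_upt diff_zero nth_map nth_upt add_0 of_bool_neq_bit)
        then show ?thesis using that x b by (simp add: dot bv_nth m_def add.commute)
      qed
      \<comment> \<open>T is b + A x, and S is orthogonal to every column of A, so only S b = 1
        survives.\<close>
      have "of_bool (dotw S T) = (\<Sum>i<m. bv S i * bv b i) + (\<Sum>i<m. \<Sum>j<n. bv x j * (bv S i * bv (A ! i) j))"
        by (simp add: of_bool_dotw S(1) bvT distrib_left sum.distrib sum_distrib_left mult_ac)
      also have "(\<Sum>i<m. \<Sum>j<n. bv x j * (bv S i * bv (A ! i) j)) = (\<Sum>j<n. bv x j * (\<Sum>i<m. bv S i * bv (A ! i) j))"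
        by (subst sum.swap) (simp add: sum_distrib_left)
      also have "\<dots> = 0" by (simp add: S(2))
      finally have "dotw S T" using S(3) by simp
      then show ?thesis using odd_card_dotw[of S m T] S(1) by (simp add: T_def)
    qed
    then have "sol odd_set ?J T" by (simp add: odd_set_def T_def)
    moreover have "{j. j < m \<and> T ! j} = {i. i < length A \<and> gf2_dot (A ! i) x \<noteq> b ! i}"
      by (auto simp: m_def T_def)
    then have "cost odd_set ?J T = cost nearest_codeword I x"
      by (simp add: odd_set_def nearest_codeword_def I)
    ultimately show "\<exists>S'. sol odd_set ?J S' \<and> cost odd_set ?J S' \<le> cost nearest_codeword I x"
      by (intro exI[of _ T]) simp
  next
    fix T assume "sol odd_set ?J T"
    then have T: "length T = m"
      and odd: "\<And>S. S \<in> set (parity_sets n A b) \<Longrightarrow> odd (card {j. j < m \<and> S ! j \<and> T ! j})"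
      by (auto simp: odd_set_def)
    have "(\<Sum>i<m. bv S i * bv T i) = 1" if "S \<in> set (parity_sets n A b)" for S
    proof -
      have "length S = m" using parity_sets_sound[OF that] by (simp add: m_def)
      then show ?thesis using odd[OF that] T odd_card_dotw[of S m T] of_bool_dotw[of S T] by simp
    qed
    \<comment> \<open>Both alternatives agree with b outside T, which is all that the restricted
      system asks for.\<close>
    from parity_sets_complete[of n A b "bv T", folded m_def, OF this]
    obtain x where x: "\<And>i. i < m \<Longrightarrow> bv T i = 0 \<Longrightarrow> (\<Sum>j<n. bv (A ! i) j * x j) = bv b i"
      by fastforce
    let ?A' = "map (\<lambda>i. if nthb T i then [] else wat A i) [0..<m]"
    let ?b' = "map (\<lambda>i. nthb b i \<and> \<not> nthb T i) [0..<m]"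
    let ?x = "solve n ?A' ?b'"
    have "\<forall>i<length ?A'. (\<Sum>j<n. bv (?A' ! i) j * x j) = bv ?b' i"
      using x by (auto simp: bv_def m_def)
    then have ax: "(\<Sum>j<n. bv (?A' ! i) j * bv ?x j) = bv ?b' i" if "i < m" for i
      using that by (intro solve_correct exI) auto
    have "gf2_dot (A ! i) ?x = b ! i" if "i < m" "\<not> T ! i" for i
    proof -
      have nT: "\<not> nthb T i" using that by (simp add: nthb_def)
      have "of_bool (gf2_dot (A ! i) ?x) = bv b i"
        using ax[OF that(1)] that(1) nT by (simp add: dot) (simp add: m_def bv_def)
      then have "of_bool (gf2_dot (A ! i) ?x) = (of_bool (b ! i) :: bit)"
        using that b by (simp only: bv_nth m_def)
      then show ?thesis by (simp only: of_bool_eq_iff)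
    qed
    then have "{i. i < length A \<and> gf2_dot (A ! i) ?x \<noteq> b ! i} \<subseteq> {j. j < m \<and> T ! j}"
      by (auto simp: m_def)
    then have "card {i. i < length A \<and> gf2_dot (A ! i) ?x \<noteq> b ! i} \<le> card {j. j < m \<and> T ! j}"
      by (intro card_mono) auto
    moreover have "?G [enc_i nearest_codeword I, T] = ?x"
      by (simp add: enc m_def wat_def cong: if_cong)
    ultimately show "\<exists>S. ?G [enc_i nearest_codeword I, enc_s odd_set T] = enc_s nearest_codeword S \<and>
        sol nearest_codeword I S \<and> cost nearest_codeword I S \<le> cost odd_set ?J T"
      by (intro exI[of _ ?x]) (simp add: nearest_codeword_def odd_set_def I cong: if_cong)
  qed
qed

subsection \<open>Odd Set to MinCSP(B2)\<close>

text \<open>Variable \<open>aux n l j\<close> holds the parity of the first j terms of the set equation in block l;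
  \<open>aux n l 0\<close> also serves as the constant 0. Each equation is
  repeated in n + 1 blocks, so that a solution of cost at most n leaves one of them intact.\<close>

definition aux :: "nat \<Rightarrow> nat \<Rightarrow> nat \<Rightarrow> nat" where
  "aux n l j = n + (l * Suc n + j)"

text \<open>The unary constraints fix the ends of the chain of partial parities to 0 and 1. The last
  slot of each EVEN4 is the constant 0, which reduces it to a relation on three variables.\<close>

definition block :: "nat \<Rightarrow> bool list \<Rightarrow> nat \<Rightarrow> (nat \<times> nat list) list" where
  "block n S l = [(2, [aux n l 0]), (1, [aux n l n])] @
     map (\<lambda>j. (0, [aux n l j, aux n l (Suc j), if nthb S j then j else aux n l 0, aux n l 0])) [0..<n]"

text \<open>The first n constraints demand j = 0; deleting one of them pays for putting j into T.
  Block l belongs to set l mod m, m being the number of sets. Since constraint lists are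
  duplicate-free, an equation cannot simply be listed again: every block has auxiliary variables of
  its own.\<close>

definition odd_set_csp :: "nat \<Rightarrow> bool list list \<Rightarrow> (nat \<times> nat list) list" where
  "odd_set_csp n Ss = map (\<lambda>j. (2, [j])) [0..<n] @
     concat (map (\<lambda>l. block n (wat Ss (l mod length Ss)) l) [0..<Suc n * length Ss])"

lemma aux_decode: "j \<le> n \<Longrightarrow> (aux n l j - n) div Suc n = l" "j \<le> n \<Longrightarrow> (aux n l j - n) mod Suc n = j"
  by (simp_all add: aux_def div_mult_self3 del: mult_Suc mult_Suc_right)

lemma aux_less: "l < k \<Longrightarrow> j \<le> n \<Longrightarrow> aux n l j < n + k * Suc n"
proof -
  assume "l < k" "j \<le> n"
  then have "l * Suc n + j < Suc l * Suc n" by simp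
  also have "\<dots> \<le> k * Suc n" using \<open>l < k\<close> by (intro mult_le_mono1) simp
  finally show ?thesis by (simp add: aux_def)
qed

lemma aux_inject: "j \<le> n \<Longrightarrow> j' \<le> n \<Longrightarrow> aux n l j = aux n l' j' \<longleftrightarrow> l = l' \<and> j = j'"
  by (metis aux_decode)

text \<open>The first variable of a constraint identifies its block. This separates the blocks for
  distinctness and lets deletions in different blocks be counted separately.\<close>

lemma in_block_head:
  assumes "c \<in> set (block n S l)"
  shows "\<exists>j\<le>n. hd (snd c) = aux n l j"
proof -
  consider "hd (snd c) = aux n l 0" | "hd (snd c) = aux n l n" | j where "j < n" "hd (snd c) = aux n l j"
    using assms by (auto simp: block_def)
  then show ?thesis by cases (metis le0, metis order_refl, metis less_imp_le)
qed

lemma distinct_concat_tagged: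
  assumes "\<And>k. k < N \<Longrightarrow> distinct (f k)" "\<And>k c. k < N \<Longrightarrow> c \<in> set (f k) \<Longrightarrow> g c = k"
  shows "distinct (concat (map f [0..<N]))"
  using assms
proof (induction N)
  case (Suc N)
  have "c \<notin> set (f N)" if "k < N" "c \<in> set (f k)" for k c
    using Suc.prems(2)[of k c] Suc.prems(2)[of N c] that by auto
  then show ?case using Suc by auto
qed simp

lemma distinct_odd_set_csp: "distinct (odd_set_csp n Ss)"
proof -
  have "distinct (block n S l)" for S l
    by (auto simp: block_def distinct_map inj_on_def aux_inject)
  moreover have "(hd (snd c) - n) div Suc n = l" if "c \<in> set (block n S l)" for c S l
    using in_block_head[OF that] aux_decode by force
  ultimately have "distinct (concat (map (\<lambda>l. block n (wat Ss (l mod length Ss)) l) [0..<Suc n * length Ss]))"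
    by (intro distinct_concat_tagged[where g = "\<lambda>c. (hd (snd c) - n) div Suc n"]) blast+
  moreover have "(2, [j]) \<notin> set (block n S l)" if "j < n" for j S l
    using in_block_head[of "(2, [j])" n S l] that by (auto simp: aux_def)
  ultimately show ?thesis
    unfolding odd_set_csp_def by (auto simp: distinct_map inj_on_def simp del: mult_Suc)
qed

lemma EVEN4_of_bool:
  "[a, b, c, d] \<in> EVEN4 \<longleftrightarrow> of_bool b = (of_bool a + of_bool c + of_bool d :: bit)"
  by (cases a; cases b; cases c; cases d) (simp_all add: EVEN4_def)

text \<open>By induction along the chain each auxiliary variable is forced to equal the partial
  parity, and the end constraint makes the total 1.\<close>

lemma block_sat:
  assumes "\<And>c. c \<in> set (block n S l) \<Longrightarrow> map \<alpha> (snd c) \<in> snd (B2 ! fst c)"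
  shows "(\<Sum>j<n. bv S j * of_bool (\<alpha> j)) = 1"
proof -
  have zero: "\<not> \<alpha> (aux n l 0)" and one: "\<alpha> (aux n l n)"
    using assms[of "(2, [aux n l 0])"] assms[of "(1, [aux n l n])"] by (auto simp: block_def B2_def)
  have "of_bool (\<alpha> (aux n l k)) = (\<Sum>j<k. bv S j * of_bool (\<alpha> j))" if "k \<le> n" for k
    using that
  proof (induction k)
    case (Suc k)
    then have "map \<alpha> [aux n l k, aux n l (Suc k), if nthb S k then k else aux n l 0, aux n l 0] \<in> EVEN4"
      using assms[of "(0, [aux n l k, aux n l (Suc k), if nthb S k then k else aux n l 0, aux n l 0])"]
      by (auto simp: block_def B2_def)
    then show ?case using Suc zero by (simp add: EVEN4_of_bool bv_def)
  qed (simp add: zero)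
  from this[of n] one show ?thesis by simp
qed

lemma block_satI:
  assumes "(\<Sum>j<n. bv S j * of_bool (\<alpha> j)) = 1"
    and \<alpha>: "\<And>k. k \<le> n \<Longrightarrow> of_bool (\<alpha> (aux n l k)) = (\<Sum>j<k. bv S j * of_bool (\<alpha> j))"
    and c: "c \<in> set (block n S l)"
  shows "map \<alpha> (snd c) \<in> snd (B2 ! fst c)"
proof -
  have "\<not> \<alpha> (aux n l 0)" "\<alpha> (aux n l n)" using \<alpha>[of 0] \<alpha>[of n] assms(1) by simp_all
  moreover have "map \<alpha> [aux n l k, aux n l (Suc k), if nthb S k then k else aux n l 0, aux n l 0] \<in> EVEN4"
    if "k < n" for k
    using \<alpha>[of k] \<alpha>[of "Suc k"] that \<open>\<not> \<alpha> (aux n l 0)\<close> by (simp add: EVEN4_of_bool bv_def)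
  ultimately show ?thesis using c by (auto simp: block_def B2_def)
qed

lemma odd_set_reduces_B2: "cp_reduces odd_set (mincsp B2)"
proof (rule cp_reducesI)
  let ?n = "\<lambda>xs. length (wat (dec (xs ! 0)) 0)"
  let ?Ss = "\<lambda>xs. dec (wat (dec (xs ! 0)) 1)"
  let ?code = "\<lambda>n Ss. map (\<lambda>j. enc_seq [bin 2, bin j]) [0..<n] @
     concat (map (\<lambda>l. [enc_seq [bin 2, bin (aux n l 0)], enc_seq [bin 1, bin (aux n l n)]] @
       map (\<lambda>j. enc_seq [bin 0, bin (aux n l j), bin (aux n l (Suc j)),
         bin (if nthb (wat Ss (l mod length Ss)) j then j else aux n l 0), bin (aux n l 0)]) [0..<n])
       [0..<Suc n * length Ss])"
  let ?F = "\<lambda>xs. enc_seq [unary (?n xs + Suc (?n xs) * length (?Ss xs) * Suc (?n xs)),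
     enc_seq (?code (?n xs) (?Ss xs))]"
  let ?ones = "\<lambda>xs. unary (length (?Ss xs))"
  \<comment> \<open>Columns outside the deleted elements are set to zero, and the solution is masked
    again because \<open>solve\<close> may choose arbitrary values there.\<close>
  let ?T1 = "\<lambda>xs. map (\<lambda>j. nthb (solve (?n xs)
      (map (\<lambda>i. map (\<lambda>j. nthb (wat (?Ss xs) i) j \<and> nthb (xs ! 1) j) [0..<?n xs]) [0..<length (?Ss xs)])
      (?ones xs)) j \<and> nthb (xs ! 1) j) [0..<?n xs]"
  \<comment> \<open>The restricted system may be unsolvable when W destroys all copies of an
    equation, so its result is tested. The alternative is an arbitrary solution, of cost at most
    n.\<close>
  let ?G = "\<lambda>xs. if \<forall>i<length (?Ss xs). dotw (wat (?Ss xs) i) (?T1 xs) then ?T1 xs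
      else solve (?n xs) (?Ss xs) (?ones xs)"
  show "pt 1 ?F" unfolding aux_def by (intro ptl_rules; simp)
  show "pt 2 ?G" by (intro ptl_rules ptb_dotw pt_solve; simp)
  fix I assume "feasible_inst odd_set I"
  moreover obtain n Ss where I: "I = (n, Ss)" by force
  ultimately obtain T0 where Ss: "\<And>i. i < length Ss \<Longrightarrow> length (Ss ! i) = n"
    and T0: "sol odd_set I T0"
    by (auto simp: feasible_inst_def odd_set_def)
  define m where "m = length Ss"
  define cs where "cs = odd_set_csp n Ss"
  have sol_iff: "sol odd_set I T \<longleftrightarrow> length T = n \<and> (\<forall>i<m. (\<Sum>j<n. bv (Ss ! i) j * bv T j) = 1)" for T
  proof -
    have "odd (card {j. j < n \<and> Ss ! i ! j \<and> T ! j}) \<longleftrightarrow> (\<Sum>j<n. bv (Ss ! i) j * bv T j) = 1"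
      if "i < m" "length T = n" for i
      using that Ss[of i] odd_card_dotw[of "Ss ! i" n T] of_bool_dotw[of "Ss ! i" T]
      by (cases "dotw (Ss ! i) T") (simp_all add: m_def)
    then show ?thesis by (auto simp: I odd_set_def all_set_conv_all_nth m_def)
  qed
  have cost_eq: "cost odd_set I T = card {j. j < n \<and> T ! j}" for T
    by (simp add: I odd_set_def)
  have costW: "cost (mincsp B2) J W = card {i. i < length W \<and> W ! i}" for J W
    by (cases J) (simp add: mincsp_def)
  have len_cs: "n \<le> length cs" and soft: "\<And>j. j < n \<Longrightarrow> cs ! j = (2, [j])"
    by (auto simp: cs_def odd_set_csp_def nth_append)
  have hard_index: "\<exists>l<Suc n * m. cs ! p \<in> set (block n (Ss ! (l mod m)) l)" if "n \<le> p" "p < length cs" for p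
  proof -
    have "cs ! p \<in> set (concat (map (\<lambda>l. block n (wat Ss (l mod m)) l) [0..<Suc n * m]))"
      using that unfolding cs_def odd_set_csp_def
      by (simp add: nth_append m_def del: mult_Suc set_concat)
    then obtain l where l: "l < Suc n * m" "cs ! p \<in> set (block n (wat Ss (l mod m)) l)"
      by (auto simp del: mult_Suc)
    then have "0 < m" by (cases m) auto
    then show ?thesis using l by (auto simp: m_def)
  qed
  let ?J = "(n + Suc n * m * Suc n, cs)"
  have enc: "dec (enc_i odd_set I) = [unary n, enc_seq Ss]"
    by (simp add: odd_set_def I)
  show "\<exists>J. ?F [enc_i odd_set I] = enc_i (mincsp B2) J \<and> inst (mincsp B2) J \<and>
      (\<forall>S. sol odd_set I S \<longrightarrow> (\<exists>S'. sol (mincsp B2) J S' \<and> cost (mincsp B2) J S' \<le> cost odd_set I S)) \<and>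
      (\<forall>S'. sol (mincsp B2) J S' \<longrightarrow> (\<exists>S. ?G [enc_i odd_set I, enc_s (mincsp B2) S'] = enc_s odd_set S \<and>
        sol odd_set I S \<and> cost odd_set I S \<le> cost (mincsp B2) J S'))"
  proof (intro exI[of _ ?J] conjI allI impI)
    have w: "wat (dec ([enc_i odd_set I] ! 0)) 0 = unary n" "dec (wat (dec ([enc_i odd_set I] ! 0)) 1) = Ss"
      by (simp_all add: enc)
    have "map (\<lambda>(r, s). enc_seq (bin r # map bin s)) cs = ?code n Ss"
      by (simp add: cs_def odd_set_csp_def block_def map_concat o_def del: mult_Suc upt_Suc)
    then show "?F [enc_i odd_set I] = enc_i (mincsp B2) ?J"
      unfolding w length_unary by (simp add: mincsp_def m_def del: mult_Suc upt_Suc)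
    show "inst (mincsp B2) ?J"
    proof -
      have valid: "fst (cs ! p) < length B2 \<and> length (snd (cs ! p)) = fst (B2 ! fst (cs ! p)) \<and>
          (\<forall>v\<in>set (snd (cs ! p)). v < n + Suc n * m * Suc n)" if p: "p < length cs" for p
      proof (cases "p < n")
        case True
        then show ?thesis by (simp add: soft B2_def)
      next
        case False
        then obtain l where l: "l < Suc n * m" "cs ! p \<in> set (block n (Ss ! (l mod m)) l)"
          using hard_index p by (auto simp: not_less)
        show ?thesis using l(2) aux_less[OF l(1)]
          by (auto simp: block_def B2_def simp del: mult_Suc mult_Suc_right intro: less_le_trans[OF _ le_add1])
      qed
      then have "\<forall>c\<in>set cs. case c of (r, s) \<Rightarrow> r < length B2 \<and> length s = fst (B2 ! r) \<and>
          (\<forall>v\<in>set s. v < n + Suc n * m * Suc n)"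
        unfolding case_prod_unfold by (metis in_set_conv_nth)
      moreover have "distinct cs" unfolding cs_def by (rule distinct_odd_set_csp)
      ultimately show ?thesis
        by (simp add: mincsp_def del: mult_Suc mult_Suc_right)
    qed
  next
    fix T assume "sol odd_set I T"
    then have T: "length T = n" "\<And>i. i < m \<Longrightarrow> (\<Sum>j<n. bv (Ss ! i) j * bv T j) = 1"
      by (auto simp: sol_iff)
    define W where "W = T @ replicate (length cs - n) False"
    \<comment> \<open>On auxiliary variables, quotient and remainder recover block and position, and
      the value is the corresponding partial parity of T.\<close>
    define \<alpha> where "\<alpha> v = (if v < n then nthb T v else
      (\<Sum>j<(v - n) mod Suc n. bv (Ss ! ((v - n) div Suc n mod m)) j * bv T j) = 1)" for v
    have \<alpha>T: "of_bool (\<alpha> j) = bv T j" if "j < n" for j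
      using that by (simp add: \<alpha>_def bv_def)
    have ob1: "of_bool (x = 1) = x" for x :: bit by (cases x) simp_all
    have \<alpha>_aux: "of_bool (\<alpha> (aux n l k)) = (\<Sum>j<k. bv (Ss ! (l mod m)) j * of_bool (\<alpha> j))" if "k \<le> n" for l k
    proof -
      have "\<not> aux n l k < n" by (simp add: aux_def)
      then have "of_bool (\<alpha> (aux n l k)) = (\<Sum>j<k. bv (Ss ! (l mod m)) j * bv T j)"
        using aux_decode[OF that, of l] by (simp add: \<alpha>_def ob1)
      then show ?thesis using that by (simp add: \<alpha>T)
    qed
    have "map \<alpha> (snd (cs ! p)) \<in> snd (B2 ! fst (cs ! p))" if p: "p < length cs" "\<not> W ! p" for p
    proof (cases "p < n")
      case True
      then show ?thesis using p T(1) by (simp add: soft B2_def \<alpha>_def W_def nth_append nthb_def)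
    next
      case False
      then obtain l where l: "l < Suc n * m" "cs ! p \<in> set (block n (Ss ! (l mod m)) l)"
        using hard_index p by (auto simp: not_less)
      then have "l mod m < m" by (cases m) auto
      then show ?thesis using l(2) \<alpha>_aux T(2) by (intro block_satI) (auto simp: \<alpha>T)
    qed
    then have "sol (mincsp B2) ?J W"
      using len_cs T(1) by (auto simp: mincsp_def W_def)
    moreover have "i < n \<and> T ! i" if "i < length W" "W ! i" for i
      using that T(1) by (cases "i < n") (auto simp: W_def nth_append)
    then have "{i. i < length W \<and> W ! i} \<subseteq> {j. j < n \<and> T ! j}"
      by blast
    then have "cost (mincsp B2) ?J W \<le> cost odd_set I T"
      unfolding costW cost_eq by (intro card_mono) auto
    ultimately show "\<exists>S'. sol (mincsp B2) ?J S' \<and> cost (mincsp B2) ?J S' \<le> cost odd_set I T"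
      by blast
  next
    fix W assume "sol (mincsp B2) ?J W"
    then obtain \<alpha> where W: "length W = length cs"
      and \<alpha>: "\<And>p. p < length cs \<Longrightarrow> \<not> W ! p \<Longrightarrow> map \<alpha> (snd (cs ! p)) \<in> snd (B2 ! fst (cs ! p))"
      by (auto simp: mincsp_def)
    define M where "M = map (\<lambda>i. map (\<lambda>j. nthb (wat Ss i) j \<and> nthb W j) [0..<n]) [0..<m]"
    define X where "X = solve n M (unary m)"
    define T1 where "T1 = map (\<lambda>j. nthb X j \<and> nthb W j) [0..<n]"
    define T2 where "T2 = solve n Ss (unary m)"
    define T where "T = (if \<forall>i<m. dotw (Ss ! i) T1 then T1 else T2)"
    have G: "?G [enc_i odd_set I, W] = T"
      by (simp add: enc T_def T1_def T2_def X_def M_def m_def cong: if_cong)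
    have unary1: "bv (unary m) i = 1" if "i < m" for i
      using that by (simp add: bv_def nthb_def unary_def)
    \<comment> \<open>Feasibility of the instance, witnessed by T0, makes the unrestricted system
      solvable whatever W is.\<close>
    have "sol odd_set I T2"
      unfolding sol_iff
    proof (intro conjI allI impI)
      fix i assume "i < m"
      have "\<exists>x. \<forall>i<length Ss. (\<Sum>j<n. bv (Ss ! i) j * x j) = bv (unary m) i"
        using T0 unfolding sol_iff m_def[symmetric] by (auto simp: unary1)
      from solve_correct[OF this, of i] \<open>i < m\<close>
      show "(\<Sum>j<n. bv (Ss ! i) j * bv T2 j) = 1"
        by (simp add: m_def T2_def unary1[unfolded m_def])
    qed (simp add: T2_def)
    have check: "dotw (Ss ! i) T1 \<longleftrightarrow> (\<Sum>j<n. bv (Ss ! i) j * bv T1 j) = 1" if "i < m" for i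
      using of_bool_dotw[of "Ss ! i" T1] that Ss[of i] by (cases "dotw (Ss ! i) T1") (auto simp: m_def)
    have "sol odd_set I T"
      using \<open>sol odd_set I T2\<close> check by (auto simp: T_def sol_iff T1_def)
    moreover have "cost odd_set I T \<le> cost (mincsp B2) ?J W"
    proof (cases "\<forall>i<m. dotw (Ss ! i) T1")
      case True
      have "{j. j < n \<and> T1 ! j} \<subseteq> {i. i < length W \<and> W ! i}"
        by (auto simp: T1_def nthb_def)
      then show ?thesis
        using True unfolding costW cost_eq T_def by (simp add: card_mono)
    next
      case False
      \<comment> \<open>Otherwise each equation would have an intact block, making the assignment
        behind W a solution of the restricted system, and \<open>T1\<close> would have passed the
        test.\<close>
      have "n < card {i. i < length W \<and> W ! i}"
      proof (rule ccontr)
        assume few: "\<not> n < card {i. i < length W \<and> W ! i}"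
        have row: "(\<Sum>j<n. bv (Ss ! i) j * of_bool (\<alpha> j)) = 1" if i: "i < m" for i
        proof (rule ccontr)
          assume no: "(\<Sum>j<n. bv (Ss ! i) j * of_bool (\<alpha> j)) \<noteq> 1"
          \<comment> \<open>The blocks of set i are those numbered k * m + i with k at most n; if
            \<open>\<alpha>\<close> violates the equation, each of them contains a deleted
            constraint.\<close>
          have "\<exists>p. p < length cs \<and> W ! p \<and> cs ! p \<in> set (block n (Ss ! i) (k * m + i))" if k: "k < Suc n" for k
          proof -
            have "\<not> (\<forall>c\<in>set (block n (Ss ! i) (k * m + i)). map \<alpha> (snd c) \<in> snd (B2 ! fst c))"
              using block_sat[of n "Ss ! i" "k * m + i" \<alpha>] no by blast
            then obtain c where c: "c \<in> set (block n (Ss ! i) (k * m + i))" "map \<alpha> (snd c) \<notin> snd (B2 ! fst c)"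
              by blast
            have "k * m + i < Suc k * m" using i by simp
            also have "\<dots> \<le> Suc n * m" using k by (intro mult_le_mono1) simp
            finally have "k * m + i < Suc n * m" .
            moreover have "c \<in> set (block n (wat Ss ((k * m + i) mod m)) (k * m + i))"
              using c(1) i by (simp add: m_def)
            ultimately have "c \<in> (\<Union>l\<in>{0..<Suc n * m}. set (block n (wat Ss (l mod m)) l))"
              by (intro UN_I[of "k * m + i"]) (simp_all del: mult_Suc)
            then have "c \<in> set cs"
              unfolding cs_def odd_set_csp_def m_def[symmetric] by (simp del: mult_Suc)
            then obtain p where "p < length cs" "cs ! p = c" by (auto simp: in_set_conv_nth)
            then show ?thesis using \<alpha>[of p] c by auto
          qed
          then obtain p where p: "\<And>k. k < Suc n \<Longrightarrow> p k < length cs \<and> W ! p k \<and>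
              cs ! p k \<in> set (block n (Ss ! i) (k * m + i))"
            by metis
          \<comment> \<open>A constraint determines its block, so the n + 1 deletions are
            distinct.\<close>
          have "k = k'" if "k < Suc n" "k' < Suc n" "p k = p k'" for k k'
          proof -
            have "k * m + i = k' * m + i"
              using in_block_head[of "cs ! p k"] p[OF that(1)] p[OF that(2)] that(3) aux_decode by metis
            then show ?thesis using i by simp
          qed
          then have "inj_on p {..<Suc n}" by (auto simp: inj_on_def)
          moreover have "p ` {..<Suc n} \<subseteq> {i. i < length W \<and> W ! i}"
            using p W by auto
          ultimately have "card {..<Suc n} \<le> card {i. i < length W \<and> W ! i}"
            by (intro card_inj_on_le) auto
          then show False using few by simp
        qed
        \<comment> \<open>An intact constraint j = 0 forces \<open>\<alpha> j\<close> to be false,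
          so \<open>\<alpha>\<close> is supported on the deleted elements and masking the columns
          does not change its sums.\<close>
        have \<alpha>W: "\<alpha> j \<Longrightarrow> nthb W j" if "j < n" for j
          using \<alpha>[of j] soft[OF that] that len_cs W by (auto simp: B2_def nthb_def)
        have M_nth: "bv (M ! i) j = bv (Ss ! i) j * bv W j" if "i < m" "j < n" for i j
          using that by (simp add: M_def bv_def m_def of_bool_conj)
        have T1_nth: "bv T1 j = bv X j * bv W j" if "j < n" for j
          using that by (simp add: T1_def bv_def of_bool_conj)
        have "(\<Sum>j<n. bv (M ! i) j * of_bool (\<alpha> j)) = bv (unary m) i" if "i < m" for i
        proof -
          have "(\<Sum>j<n. bv (M ! i) j * of_bool (\<alpha> j)) = (\<Sum>j<n. bv (Ss ! i) j * of_bool (\<alpha> j))"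
          proof (rule sum.cong[OF refl])
            fix j assume "j \<in> {..<n}"
            then show "bv (M ! i) j * of_bool (\<alpha> j) = bv (Ss ! i) j * of_bool (\<alpha> j)"
              using \<alpha>W[of j] that by (cases "\<alpha> j") (simp_all add: M_nth bv_def[of W])
          qed
          then show ?thesis using row that by (simp add: unary1)
        qed
        moreover have len_M: "length M = m" by (simp add: M_def)
        ultimately have "\<exists>x. \<forall>i<length M. (\<Sum>j<n. bv (M ! i) j * x j) = bv (unary m) i"
          by (intro exI[of _ "\<lambda>j. of_bool (\<alpha> j)"]) simp
        from solve_correct[OF this, unfolded len_M]
        have "(\<Sum>j<n. bv (M ! i) j * bv X j) = 1" if "i < m" for i
          unfolding X_def using that by (simp add: unary1)
        moreover have "(\<Sum>j<n. bv (M ! i) j * bv X j) = (\<Sum>j<n. bv (Ss ! i) j * bv T1 j)" if "i < m" for i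
          using that by (intro sum.cong) (simp_all add: M_nth T1_nth mult_ac)
        ultimately show False using False check by auto
      qed
      moreover have "card {j. j < n \<and> T ! j} \<le> n"
        using card_mono[of "{..<n}" "{j. j < n \<and> T ! j}"] by auto
      ultimately show ?thesis unfolding costW cost_eq by simp
    qed
    ultimately show "\<exists>S. ?G [enc_i odd_set I, enc_s (mincsp B2) W] = enc_s odd_set S \<and>
        sol odd_set I S \<and> cost odd_set I S \<le> cost (mincsp B2) ?J W"
      using G by (intro exI[of _ T]) (simp add: mincsp_def[of B2] odd_set_def cong: if_cong)
  qed
qed

theorem theorem9:
  shows "cp_equivalent nearest_codeword odd_set \<and>
         cp_equivalent nearest_codeword (mincsp B2) \<and>
         cp_equivalent nearest_codeword (mincsp B3) \<and>
         cp_equivalent odd_set (mincsp B2) \<and>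
         cp_equivalent odd_set (mincsp B3) \<and>
         cp_equivalent (mincsp B2) (mincsp B3)"
  using nearest_codeword_reduces_odd_set odd_set_reduces_B2 B2_reduces_B3 B3_reduces_nearest_codeword
  unfolding cp_equivalent_def by (meson cp_reduces_trans)

end
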